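(* Let $n\ge 1$ be an integer, let $\Gamma=\mathrm{PSL}_2(\mathbb{Z})$, and let $\mathcal{M}_n$ be the set of $2\times 2$ integral matrices of determinant $n$ modulo $\pm 1$, on which $\Gamma$ acts by right multiplication. For a right coset $K\in\mathcal{M}_n/\Gamma$ let $\delta_K=\gcd(c,d)$, where $\begin{pmatrix} a&b\\ c&d\end{pmatrix}$ is any representative of $K$, and let $\delta_K'=n/\delta_K$. Then for each right coset $K\in\mathcal{M}_n/\Gamma$, \[ \sum_{\substack{M\in K\\ M\text{ elliptic}}}\chi(z_M)\;=\;1+\operatorname{sgn}(\delta_K'-\delta_K)+\begin{cases}1/6 & \text{if } K=\sqrt{n}\,\Gamma,\\ 0&\text{otherwise.}\end{cases} \]
   Context: A matrix $M\in\mathcal{M}_n$ is called elliptic if $(\operatorname{tr} M)^2<4\det M$; then $M$ (acting by Möbius transformations) has a unique fixed point $z_M$ in the upper half-plane $\mathfrak{H}=\{z\in\mathbb{C}:\operatorname{Im} z>0\}$. The coset $\sqrt{n}\,\Gamma$ (which exists only when $n$ is a perfect square) is the coset of the scalar matrix $\sqrt{n}\,I$. Let $\mathcal{F}=\{z\in\mathfrak{H}:-1/2\le \operatorname{Re} z\le 1/2,\ |z|\ge 1\}$ be the standard fundamental domain. The function $\chi:\mathfrak{H}\to\mathbb{Q}$ is defined by $\chi(z)=\frac{1}{2\pi}\times$(the angle subtended by $\mathcal{F}$ at $z$), i.e. the limiting fraction of a small disc around $z$ lying in $\mathcal{F}$: thus $\chi=1$ in the interior of $\mathcal{F}$, $0$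 outside $\mathcal{F}$, $1/2$ at boundary points of $\mathcal{F}$ other than the corners $\rho=e^{\pi i/3}$ and $\rho^2$, and $1/6$ at $\rho$ and $\rho^2$. *)

theory Defs
  imports "HOL-Analysis.Analysis"
begin

definition pm_eq :: "int^2^2 \<Rightarrow> int^2^2 \<Rightarrow> bool" where
  "pm_eq A B \<longleftrightarrow> A = B \<or> A = - B"

text \<open>Integral \<open>2 \<times> 2\<close> matrices modulo \<open>\<plusminus>1\<close>.\<close>
quotient_type pmat = "int^2^2" / pm_eq
  by (auto simp: pm_eq_def intro!: equivpI reflpI sympI transpI)

lemma det_uminus_2: "det (- A) = det (A :: int^2^2)"
  by (simp add: det_2)

lemma trace_uminus_2: "trace (- A) = - trace (A :: int^2^2)"
  by (simp add: trace_def sum_2)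

lemma uminus_matrix_mult: "(- A) ** B = - (A ** (B :: int^2^2))" "A ** (- B) = - (A ** (B :: int^2^2))"
  by (simp_all add: vec_eq_iff matrix_matrix_mult_def sum_2)

lift_definition pdet :: "pmat \<Rightarrow> int" is det
  by (auto simp: pm_eq_def det_uminus_2)

lift_definition pmult :: "pmat \<Rightarrow> pmat \<Rightarrow> pmat" (infixl "\<odot>" 70) is "(**)"
  by (auto simp: pm_eq_def uminus_matrix_mult)

lift_definition pscalar :: "int \<Rightarrow> pmat" is mat .

lift_definition elliptic :: "pmat \<Rightarrow> bool" is "\<lambda>A. (trace A)\<^sup>2 < 4 * det A"
  by (auto simp: pm_eq_def det_uminus_2 trace_uminus_2)

lift_definition pmoebius :: "pmat \<Rightarrow> complex \<Rightarrow> complex" is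
  "\<lambda>A. moebius (of_int (A$1$1)) (of_int (A$1$2)) (of_int (A$2$1)) (of_int (A$2$2))"
proof -
  fix A B :: "int^2^2"
  have "moebius (- a) (- b) (- c) (- d) = moebius a b c d" for a b c d :: complex
  proof
    fix z
    have "- a * z + - b = - (a * z + b)" "- c * z + - d = - (c * z + d)"
      by simp_all
    thus "moebius (- a) (- b) (- c) (- d) z = moebius a b c d z"
      unfolding moebius_def by (metis minus_divide_divide)
  qed
  thus "pm_eq A B \<Longrightarrow>
      moebius (of_int (A$1$1)) (of_int (A$1$2)) (of_int (A$2$1)) (of_int (A$2$2) :: complex) =
      moebius (of_int (B$1$1)) (of_int (B$1$2)) (of_int (B$2$1)) (of_int (B$2$2))"
    by (auto simp: pm_eq_def)
qed

lift_definition bottom_gcd :: "pmat \<Rightarrow> int" is "\<lambda>A. gcd (A$2$1) (A$2$2)"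
  by (auto simp: pm_eq_def)

definition upper_half_plane :: "complex set" where
  "upper_half_plane = {z. Im z > 0}"

definition fixed_pt :: "pmat \<Rightarrow> complex" where
  "fixed_pt M = (THE z. z \<in> upper_half_plane \<and> pmoebius M z = z)"

definition Mn :: "nat \<Rightarrow> pmat set" where
  "Mn n = {M. pdet M = int n}"

definition Gamma :: "pmat set" where
  "Gamma = Mn 1"

definition coset :: "pmat \<Rightarrow> pmat set" where
  "coset M = (\<lambda>g. M \<odot> g) ` Gamma"

definition cosets :: "nat \<Rightarrow> pmat set set" where
  "cosets n = coset ` Mn n"

text \<open>The value \<open>gcd(c, d)\<close> is constant on each coset; see \<open>delta_eq\<close> below.\<close>
definition delta :: "pmat set \<Rightarrow> int" where
  "delta K = the_elem (bottom_gcd ` K)"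

definition fund_dom :: "complex set" where
  "fund_dom = {z \<in> upper_half_plane. - 1/2 \<le> Re z \<and> Re z \<le> 1/2 \<and> 1 \<le> cmod z}"

definition chi :: "complex \<Rightarrow> real" where
  "chi z = Lim (at_right 0)
     (\<lambda>r. measure lborel (ball z r \<inter> fund_dom) / measure lborel (ball z r))"

lemma bottom_gcd_pmult:
  assumes "pdet g = 1"
  shows "bottom_gcd (M \<odot> g) = bottom_gcd M"
  using assms
proof (transfer, goal_cases)
  case (1 g M)
  let ?c = "M$2$1" and ?d = "M$2$2"
  define c' where "c' = ?c * g$1$1 + ?d * g$2$1"
  define d' where "d' = ?c * g$1$2 + ?d * g$2$2"
  have g: "g$1$1 * g$2$2 - g$1$2 * g$2$1 = 1"
    using 1 by (simp add: det_2)
  have "c' * g$2$2 - d' * g$2$1 = ?c * (g$1$1 * g$2$2 - g$1$2 * g$2$1)"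
       "d' * g$1$1 - c' * g$1$2 = ?d * (g$1$1 * g$2$2 - g$1$2 * g$2$1)"
    by (simp_all add: c'_def d'_def algebra_simps)
  hence inv: "?c = c' * g$2$2 - d' * g$2$1" "?d = d' * g$1$1 - c' * g$1$2"
    using g by simp_all
  have "gcd c' d' dvd ?c" "gcd c' d' dvd ?d"
    by (subst inv, simp)+
  moreover have "gcd ?c ?d dvd c'" "gcd ?c ?d dvd d'"
    by (simp_all add: c'_def d'_def)
  ultimately have "gcd c' d' = gcd ?c ?d"
    by (intro zdvd_antisym_nonneg) auto
  thus ?case
    by (simp add: matrix_matrix_mult_def sum_2 c'_def d'_def)
qed

lemma delta_eq:
  assumes "K \<in> cosets n" "M \<in> K"
  shows "delta K = bottom_gcd M"
proof -
  obtain N where K: "K = (\<lambda>g. N \<odot> g) ` Gamma"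
    using assms(1) by (auto simp: cosets_def coset_def)
  have *: "bottom_gcd M' = bottom_gcd N" if "M' \<in> K" for M'
    using that by (auto simp: K Gamma_def Mn_def bottom_gcd_pmult)
  have "bottom_gcd ` K = {bottom_gcd N}"
    using * assms(2) by (metis image_cong image_constant_conv empty_iff)
  thus ?thesis
    using * assms(2) by (simp add: delta_def)
qed

lemma elliptic_fixed_pt:
  assumes "elliptic M"
  shows "\<exists>!z. z \<in> upper_half_plane \<and> pmoebius M z = z"
  using assms
proof (transfer, goal_cases)
  case (1 A)
  define a b c d :: real
    where "a = A$1$1" and "b = A$1$2" and "c = A$2$1" and "d = A$2$2"
  have "real_of_int ((trace A)\<^sup>2) < real_of_int (4 * det A)"
    using 1 by linarith
  hence ell: "(a + d)\<^sup>2 < 4 * (a * d - b * c)"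
    by (simp add: trace_def det_2 sum_2 a_def b_def c_def d_def)
  define D where "D = 4 * (a * d - b * c) - (a + d)\<^sup>2"
  have D: "D > 0" "(a - d)\<^sup>2 + 4 * b * c = - D"
    using ell by (simp_all add: D_def power2_eq_square algebra_simps)
  have c: "c \<noteq> 0"
    using D by (metis add.right_neutral mult_zero_right neg_less_0_iff_less not_less zero_le_power2)
  have iff: "moebius (of_real a) (of_real b) (of_real c) (of_real d) z = z \<longleftrightarrow>
      2 * c * Re z = a - d \<and> (2 * c * Im z)\<^sup>2 = D" if "Im z > 0" for z :: complex
  proof -
    define x y where "x = Re z" and "y = Im z"
    have y: "y > 0" using that by (simp add: y_def)
    have nz: "of_real c * z + of_real d \<noteq> 0"
      using c that by (auto simp: complex_eq_iff)
    have "moebius (of_real a) (of_real b) (of_real c) (of_real d) z = z \<longleftrightarrow>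
        of_real a * z + of_real b = z * (of_real c * z + of_real d)"
      using nz by (simp add: divide_eq_eq moebius_def)
    also have "\<dots> \<longleftrightarrow> a * x + b = x * (c * x + d) - y * (c * y) \<and> a * y = x * (c * y) + y * (c * x + d)"
      by (simp add: complex_eq_iff x_def y_def)
    also have "a * y = x * (c * y) + y * (c * x + d) \<longleftrightarrow> y * (2 * c * x - (a - d)) = 0"
      by (auto simp: algebra_simps)
    also have "\<dots> \<longleftrightarrow> 2 * c * x = a - d"
      using y by simp
    also have "a * x + b = x * (c * x + d) - y * (c * y) \<and> 2 * c * x = a - d \<longleftrightarrow>
        2 * c * x = a - d \<and> (2 * c * y)\<^sup>2 = D"
    proof -
      have "a * x + b = x * (c * x + d) - y * (c * y) \<longleftrightarrow> (2 * c * y)\<^sup>2 = D"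
        if eq: "2 * c * x = a - d"
      proof -
        have "4 * c * (x * (c * x + d) - y * (c * y) - (a * x + b)) =
            (2 * c * x)\<^sup>2 - 2 * (a - d) * (2 * c * x) - 4 * b * c - (2 * c * y)\<^sup>2"
          by (simp add: power2_eq_square algebra_simps)
        also have "\<dots> = D - (2 * c * y)\<^sup>2"
          unfolding eq using D(2) by (simp add: power2_eq_square algebra_simps)
        finally show ?thesis
          using c by (smt (verit) mult_eq_0_iff)
      qed
      thus ?thesis by blast
    qed
    finally show ?thesis by (simp add: x_def y_def)
  qed
  have "\<exists>!z. z \<in> upper_half_plane \<and>
      moebius (of_real a) (of_real b) (of_real c) (of_real d) z = z"
  proof (rule ex1I)
    let ?z = "Complex ((a - d) / (2 * c)) (sqrt D / (2 * \<bar>c\<bar>))"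
    have pos: "Im ?z > 0"
      using D(1) c by simp
    have "(2 * c * Im ?z)\<^sup>2 = D"
      using D(1) c by (simp add: power_mult_distrib power_divide)
    thus "?z \<in> upper_half_plane \<and> moebius (of_real a) (of_real b) (of_real c) (of_real d) ?z = ?z"
      using pos c by (subst iff) (simp_all add: upper_half_plane_def)
    fix w
    assume w: "w \<in> upper_half_plane \<and> moebius (of_real a) (of_real b) (of_real c) (of_real d) w = w"
    hence Im: "Im w > 0" by (simp add: upper_half_plane_def)
    from w iff[OF Im] have *: "2 * c * Re w = a - d" "(2 * c * Im w)\<^sup>2 = D"
      by simp_all
    have "sqrt D = 2 * \<bar>c\<bar> * Im w"
      using Im by (simp flip: *(2) add: abs_mult)
    thus "w = ?z"
      using c *(1) by (auto simp: complex_eq_iff field_simps)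
  qed
  thus ?case by (simp add: a_def b_def c_def d_def)
qed

end

theory Submission
  imports Defs
begin

text \<open>
  Write \<open>K\<close> as the coset of \<open>\<delta> (y, x; 0, 1)\<close>. In the coordinates \<open>(Re z, |z|\<^sup>2)\<close> the fundamental
  domain is a half-strip, and for each \<open>g\<close> in \<open>PSL(2, \<int>)\<close> the set of \<open>(x, y)\<close> for which
  \<open>(y, x; 0, 1) g\<close> has its fixed point in the domain is an affine image of it, a tile. The sum is
  the weighted number of tiles containing \<open>(x, y)\<close>. Along every wall off the line \<open>y = 1\<close> the
  tiles on both sides match up, so on a vertical line avoiding the vertices (that is, with \<open>x\<close> not
  an integer) this number is constant except for a jump by 2 at \<open>y = 1\<close>; it vanishes for \<open>y < 1\<close>.
  For integral \<open>x\<close> and \<open>y \<noteq> 1\<close> it is the mean of the values at \<open>x \<plusminus> h\<close>, and for integral \<open>x\<close>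
  and \<open>y = 1\<close> (the coset of a scalar matrix) five tiles contribute \<open>7/6\<close>.
\<close>

text \<open>All slacks are affine in (x, y), so a tile starts or stops containing a point only at
  one of its walls. Crossing a wall, one tile is left and the neighbour with the opposite slack is
  entered. The obstacle is the normalisation c > 0. The neighbour of (a, b; c, d) across its bottom
  wall has lower left entry d up to sign, so for d = 0 there is none. Determinant 1 then gives c =
  1, b = -1, which puts the wall on y = 1, and |a + x| < 1 has two integral solutions a: hence the
  jump by 2.

  The starting value 0 comes from y = d (a y + c x) - c (b y + d x), which on a tile is at least c^2
  - c |d| + d^2 >= 1.

  At a vertex the weight is 1/6, not the mean of the values on both sides of a wall, so the pairing
  breaks down; but a vertex has integral x. There the comparison runs horizontally instead: the
  corner errors cancel in triples as long as no tile at the vertex has d = 0 or c + d = 0 (c - d = 0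
  at left corners), which is ensured by y \<noteq> 1. On y = 1 the bottom walls with d = 0 are
  themselves horizontal, the mean at x +- h is 1, and the value has to be found from an explicit
  list of tiles.\<close>

section \<open>Counting tiles\<close>

text \<open>The value of \<open>chi\<close> at \<open>z\<close>, as a function of quantities with the signs of \<open>1/2 - Re z\<close>,
  \<open>Re z + 1/2\<close> and \<open>|z| - 1\<close>.\<close>

definition domain_weight :: "real \<Rightarrow> real \<Rightarrow> real \<Rightarrow> real" where
  "domain_weight r l b = (if r < 0 \<or> l < 0 \<or> b < 0 then 0
     else if b = 0 \<and> (r = 0 \<or> l = 0) then 1/6
     else if b = 0 \<or> r = 0 \<or> l = 0 then 1/2 else 1)"

lemma domain_weight_scale: "k > 0 \<Longrightarrow> domain_weight (k * r) (k * l) (k * b) = domain_weight r l b"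
  by (auto simp: domain_weight_def mult_less_0_iff)

text \<open>If \<open>r + l > 0\<close>, then away from the corners at most one slack vanishes.
  Motion in the direction \<open>(p, q, s)\<close> turns the weight 1/2 of a wall into 1 or 0, by
  the sign of the increment of that slack, or keeps it when running along the wall. This is the
  resulting coefficient of \<open>sgn h\<close>.\<close>

definition domain_weight_jump :: "real \<Rightarrow> real \<Rightarrow> real \<Rightarrow> real \<Rightarrow> real \<Rightarrow> real \<Rightarrow> real" where
  "domain_weight_jump r l b p q s =
     ((if r = 0 \<and> b > 0 then sgn p else 0) + (if l = 0 \<and> b > 0 then sgn q else 0) +
      (if b = 0 \<and> r > 0 \<and> l > 0 then sgn s else 0)) / 2"

lemma eventually_sgn_affine:
  fixes r p :: real
  shows "\<forall>\<^sub>F h in nhds 0. sgn (r + p * h) = (if r = 0 then sgn p * sgn h else sgn r)"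
proof (cases r "0 :: real" rule: linorder_cases)
  case equal
  thus ?thesis by (simp add: sgn_mult)
next
  case less
  have "((\<lambda>h. r + p * h) \<longlongrightarrow> r + p * 0) (nhds 0)" by (intro tendsto_intros filterlim_ident)
  hence "\<forall>\<^sub>F h in nhds 0. r + p * h < 0" using less by (intro order_tendstoD) auto
  thus ?thesis using less by (auto elim!: eventually_mono)
next
  case greater
  have "((\<lambda>h. r + p * h) \<longlongrightarrow> r + p * 0) (nhds 0)" by (intro tendsto_intros filterlim_ident)
  hence "\<forall>\<^sub>F h in nhds 0. r + p * h > 0" using greater by (intro order_tendstoD) auto
  thus ?thesis using greater by (auto elim!: eventually_mono)
qed

lemma domain_weight_cong_sgn:
  assumes "sgn r = sgn r'" "sgn l = sgn l'" "sgn b = sgn b'"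
  shows "domain_weight r l b = domain_weight r' l' b'"
proof -
  have *: "(u < 0 \<longleftrightarrow> u' < 0) \<and> (u = 0 \<longleftrightarrow> u' = 0)" if "sgn u = sgn u'" for u u' :: real
    using that by (metis sgn_0_0 sgn_less)
  show ?thesis unfolding domain_weight_def using *[OF assms(1)] *[OF assms(2)] *[OF assms(3)] by simp
qed

lemma domain_weight_sgn: "domain_weight (sgn r) (sgn l) (sgn b) = domain_weight r l b"
  by (rule domain_weight_cong_sgn) simp_all

text \<open>The factor \<open>sgn h\<close> carries the direction, so one formula covers both sides
  of a wall and \<open>h = 0\<close>.\<close>

lemma eventually_domain_weight_affine:
  assumes "r + l > 0" "\<not> (b = 0 \<and> (r = 0 \<or> l = 0))"
  shows "\<forall>\<^sub>F h in nhds 0. domain_weight (r + p * h) (l + q * h) (b + s * h) =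
           domain_weight r l b + sgn h * domain_weight_jump r l b p q s"
  using eventually_sgn_affine[of r p] eventually_sgn_affine[of l q] eventually_sgn_affine[of b s]
proof eventually_elim
  case (elim h)
  have "domain_weight (r + p * h) (l + q * h) (b + s * h) =
    domain_weight (if r = 0 then sgn p * sgn h else sgn r) (if l = 0 then sgn q * sgn h else sgn l)
       (if b = 0 then sgn s * sgn h else sgn b)"
    by (subst domain_weight_sgn [symmetric]) (simp add: elim)
  also have "\<dots> = domain_weight r l b + sgn h * domain_weight_jump r l b p q s"
  proof -
    have half: "domain_weight (sgn u) 1 1 = (1 + sgn u) / 2" "domain_weight 1 (sgn u) 1 = (1 + sgn u) / 2"
      "domain_weight 1 1 (sgn u) = (1 + sgn u) / 2" for u
      by (auto simp: domain_weight_def sgn_real_def)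
    have vals: "\<lbrakk>r > 0; l > 0; b > 0\<rbrakk> \<Longrightarrow> domain_weight r l b = 1" "\<lbrakk>l > 0; b > 0\<rbrakk> \<Longrightarrow> domain_weight 0 l b = 1/2"
      "\<lbrakk>r > 0; b > 0\<rbrakk> \<Longrightarrow> domain_weight r 0 b = 1/2" "\<lbrakk>r > 0; l > 0\<rbrakk> \<Longrightarrow> domain_weight r l 0 = 1/2" for r l b
      by (simp_all add: domain_weight_def)
    consider "r < 0 \<or> l < 0 \<or> b < 0" | "r > 0" "l > 0" "b > 0" | "r = 0" "l > 0" "b > 0"
      | "l = 0" "r > 0" "b > 0" | "b = 0" "r > 0" "l > 0"
      using assms by linarith
    thus ?thesis
    proof cases
      case 1
      hence "domain_weight_jump r l b p q s = 0" using assms by (auto simp: domain_weight_jump_def)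
      moreover have "domain_weight r l b = 0" using 1 by (simp add: domain_weight_def)
      ultimately show ?thesis using 1 by (elim disjE) (simp_all add: domain_weight_def)
    qed (auto simp: domain_weight_jump_def half vals mult.commute simp flip: sgn_mult)
  qed
  finally show ?case .
qed

section \<open>Tiles in the (x, y)-plane and their bounds\<close>

text \<open>Representatives \<open>(a, b; c, d)\<close> of the elements of \<open>PSL(2, \<int>)\<close> with \<open>c \<noteq> 0\<close>. If \<open>z\<close> is the fixed
  point of \<open>(y, x; 0, 1) (a, b; c, d)\<close>, then the three slacks below are \<open>c (1 - 2 Re z)\<close>,
  \<open>c (1 + 2 Re z)\<close> and \<open>c (|z|\<^sup>2 - 1)\<close>; the tile of the element is where they are nonnegative.\<close>

type_synonym quad = "int \<times> int \<times> int \<times> int"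

definition SL2_pos :: "quad set" where
  "SL2_pos = {(a,b,c,d). a * d - b * c = 1 \<and> c > 0}"

fun slack_right slack_left slack_bottom :: "quad \<Rightarrow> real \<Rightarrow> real \<Rightarrow> real" where
  "slack_right (a,b,c,d) x y = of_int c + of_int d - (of_int a * y + of_int c * x)"
| "slack_left (a,b,c,d) x y = of_int c - of_int d + (of_int a * y + of_int c * x)"
| "slack_bottom (a,b,c,d) x y = - (of_int b * y + of_int d * x) - of_int c"

definition tile_weight :: "quad \<Rightarrow> real \<Rightarrow> real \<Rightarrow> real" where
  "tile_weight g x y = domain_weight (slack_right g x y) (slack_left g x y) (slack_bottom g x y)"

text \<open>The matrix with rows (A, B) and (c, d) has determinant y, that is, y = d A - c B. On a
  tile |A - d| <= c and B <= -c, which bounds both products from below. Equality makes both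
  estimates tight: the point lies on the bottom edge, and at a corner if d \<noteq> 0.\<close>

lemma strip_bound:
  assumes "(a,b,c,d) \<in> SL2_pos" "slack_right (a,b,c,d) x y \<ge> 0" "slack_left (a,b,c,d) x y \<ge> 0" "slack_bottom (a,b,c,d) x y \<ge> 0"
  shows "of_int (c\<^sup>2 - c * \<bar>d\<bar> + d\<^sup>2) \<le> y"
    and "of_int (c\<^sup>2 - c * \<bar>d\<bar> + d\<^sup>2) = y \<Longrightarrow> slack_bottom (a,b,c,d) x y = 0 \<and>
           (d \<noteq> 0 \<longrightarrow> slack_right (a,b,c,d) x y = 0 \<or> slack_left (a,b,c,d) x y = 0)"
proof -
  define A where "A = of_int a * y + of_int c * x"
  define B where "B = of_int b * y + of_int d * x"
  have det: "a * d - b * c = 1" and c: "c > 0" using assms by (auto simp: SL2_pos_def)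
  have *: "real_of_int a * of_int d - of_int b * of_int c = 1"
    using det by (metis of_int_1 of_int_diff of_int_mult)
  have "y = (of_int a * of_int d - of_int b * of_int c) * y" using * by simp
  also have "\<dots> = of_int d * A - of_int c * B" by (simp add: A_def B_def algebra_simps)
  finally have y: "y = of_int d * A - of_int c * B" .
  have h: "A - of_int d \<le> of_int c" "- of_int c \<le> A - of_int d" "B \<le> - of_int c"
    using assms by (auto simp: A_def B_def)
  have slack_bottom: "of_int c * (- of_int c - B) \<ge> 0" using h c by simp
  have "\<bar>of_int d * (A - of_int d)\<bar> \<le> real_of_int \<bar>d\<bar> * of_int c"
    unfolding abs_mult using h by (intro mult_mono) auto
  hence dA: "of_int d * (A - of_int d) \<ge> - (real_of_int \<bar>d\<bar> * of_int c)" by linarith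
  have eq: "y - of_int (c\<^sup>2 - c * \<bar>d\<bar> + d\<^sup>2) =
      of_int c * (- of_int c - B) + (of_int d * (A - of_int d) + real_of_int \<bar>d\<bar> * of_int c)"
    unfolding y by (simp add: power2_eq_square algebra_simps)
  show "of_int (c\<^sup>2 - c * \<bar>d\<bar> + d\<^sup>2) \<le> y" using eq slack_bottom dA by linarith
  assume "of_int (c\<^sup>2 - c * \<bar>d\<bar> + d\<^sup>2) = y"
  hence z: "of_int c * (- of_int c - B) = 0" "of_int d * (A - of_int d) + real_of_int \<bar>d\<bar> * of_int c = 0"
    using eq slack_bottom dA by linarith+
  have "of_int d * (A - of_int d + of_int c) = 0 \<or> of_int d * (A - of_int d - of_int c) = 0"
    using z(2) by (cases "d \<ge> 0") (auto simp: algebra_simps)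
  hence "d \<noteq> 0 \<longrightarrow> A - of_int d + of_int c = 0 \<or> A - of_int d - of_int c = 0" by auto
  thus "slack_bottom (a,b,c,d) x y = 0 \<and>
           (d \<noteq> 0 \<longrightarrow> slack_right (a,b,c,d) x y = 0 \<or> slack_left (a,b,c,d) x y = 0)"
    using z(1) c by (auto simp: A_def B_def)
qed

text \<open>Twice the form is (c - |d|)^2 + c^2 + d^2. An upper bound on y therefore bounds c and d
  through \<open>strip_bound\<close>.\<close>

lemma int_form_bounds:
  fixes c d :: int
  assumes "c > 0"
  shows "c\<^sup>2 - c * \<bar>d\<bar> + d\<^sup>2 \<ge> 1" "c \<le> 2 * (c\<^sup>2 - c * \<bar>d\<bar> + d\<^sup>2)" "\<bar>d\<bar> \<le> 2 * (c\<^sup>2 - c * \<bar>d\<bar> + d\<^sup>2)"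
proof -
  have "(c - \<bar>d\<bar>)\<^sup>2 \<ge> 0" by simp
  hence *: "2 * (c\<^sup>2 - c * \<bar>d\<bar> + d\<^sup>2) \<ge> c\<^sup>2 + d\<^sup>2"
    by (simp add: power2_eq_square algebra_simps)
  have c2: "c\<^sup>2 \<ge> c" using assms by (simp add: power2_eq_square)
  have d2: "d\<^sup>2 \<ge> \<bar>d\<bar>"
  proof (cases "d = 0")
    case False
    hence "\<bar>d\<bar> * 1 \<le> \<bar>d\<bar> * \<bar>d\<bar>" by (intro mult_left_mono) auto
    thus ?thesis by (simp add: power2_eq_square)
  qed simp
  define Q where "Q = c\<^sup>2 - c * \<bar>d\<bar> + d\<^sup>2"
  have "Q \<ge> 1 \<and> c \<le> 2 * Q \<and> \<bar>d\<bar> \<le> 2 * Q"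
    using *[folded Q_def] c2 d2 assms zero_le_power2[of c] zero_le_power2[of d] by linarith
  thus "c\<^sup>2 - c * \<bar>d\<bar> + d\<^sup>2 \<ge> 1" "c \<le> 2 * (c\<^sup>2 - c * \<bar>d\<bar> + d\<^sup>2)" "\<bar>d\<bar> \<le> 2 * (c\<^sup>2 - c * \<bar>d\<bar> + d\<^sup>2)"
    by (simp_all add: Q_def)
qed

lemma tile_weight_nonzeroD:
  assumes "tile_weight g x y \<noteq> 0"
  shows "slack_right g x y \<ge> 0" "slack_left g x y \<ge> 0" "slack_bottom g x y \<ge> 0"
  using assms by (auto simp: tile_weight_def domain_weight_def split: if_splits)

lemma tile_weight_eq_0_of_less_1:
  assumes "g \<in> SL2_pos" "y < 1"
  shows "tile_weight g x y = 0"
proof (rule ccontr)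
  assume nz: "tile_weight g x y \<noteq> 0"
  obtain a b c d where g: "g = (a,b,c,d)" by (cases g)
  have "of_int (c\<^sup>2 - c * \<bar>d\<bar> + d\<^sup>2) \<le> y"
    using strip_bound(1) tile_weight_nonzeroD[OF nz] assms unfolding g by blast
  moreover have "c\<^sup>2 - c * \<bar>d\<bar> + d\<^sup>2 \<ge> 1" using assms g by (intro int_form_bounds) (auto simp: SL2_pos_def)
  ultimately show False using assms by linarith
qed

text \<open>One finite set that serves a whole region allows the sums at neighbouring points to be
  compared term by term.\<close>

lemma finite_support:
  obtains G where "finite G" "G \<subseteq> SL2_pos"
    "\<And>g x y. g \<in> SL2_pos \<Longrightarrow> \<bar>x\<bar> \<le> X \<Longrightarrow> y \<le> Y \<Longrightarrow> tile_weight g x y \<noteq> 0 \<Longrightarrow> g \<in> G"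
proof -
  \<comment> \<open>The form bounds c and |d| by \<open>m\<close>. The side walls give |a| y <= c +
    |d| + c |x| with y >= 1, hence the bound \<open>k\<close>. Finally |b| <= |b c| = |a d - 1|,
    hence \<open>k*m+1\<close>.\<close>
  define m where "m = \<lceil>2 * \<bar>Y\<bar>\<rceil>"
  define k where "k = \<lceil>of_int m * (2 + X)\<rceil>"
  define G where "G = SL2_pos \<inter> ({-k..k} \<times> {-(k*m+1)..k*m+1} \<times> {-m..m} \<times> {-m..m})"
  show ?thesis
  proof (rule that[of G])
    show "finite G" "G \<subseteq> SL2_pos" by (auto simp: G_def)
    fix g x y assume g: "g \<in> SL2_pos" and x: "\<bar>x\<bar> \<le> X" and y: "y \<le> Y" and nz: "tile_weight g x y \<noteq> 0"
    obtain a b c d where geq: "g = (a,b,c,d)" by (cases g)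
    have det: "a * d - b * c = 1" and c: "c > 0" using g by (auto simp: geq SL2_pos_def)
    note sb = tile_weight_nonzeroD[OF nz, unfolded geq]
    have le: "of_int (c\<^sup>2 - c * \<bar>d\<bar> + d\<^sup>2) \<le> y"
      using strip_bound(1)[OF _ sb] g unfolding geq by blast
    define Q where "Q = c\<^sup>2 - c * \<bar>d\<bar> + d\<^sup>2"
    note fb = int_form_bounds[OF c, of d, folded Q_def] and le = le[folded Q_def]
    have y1: "y \<ge> 1" using le fb(1) by linarith
    have "real_of_int c \<le> 2 * of_int Q" "real_of_int \<bar>d\<bar> \<le> 2 * of_int Q"
      using fb(2,3) by linarith+
    hence "real_of_int c \<le> 2 * \<bar>Y\<bar>" "real_of_int \<bar>d\<bar> \<le> 2 * \<bar>Y\<bar>" using le y by linarith+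
    hence cd: "c \<le> m" "\<bar>d\<bar> \<le> m" unfolding m_def by linarith+
    have "\<bar>of_int a * y + of_int c * x\<bar> \<le> of_int c + of_int \<bar>d\<bar>" using sb by auto
    moreover have "\<bar>of_int c * x\<bar> \<le> of_int c * X" unfolding abs_mult using c x by (intro mult_mono) auto
    ultimately have "\<bar>of_int a * y\<bar> \<le> of_int c + of_int \<bar>d\<bar> + of_int c * X" by linarith
    moreover have "of_int \<bar>a\<bar> * 1 \<le> of_int \<bar>a\<bar> * y" using y1 by (intro mult_left_mono) auto
    moreover have "of_int c * X \<le> of_int m * X" using cd x by (intro mult_right_mono) auto
    ultimately have "of_int \<bar>a\<bar> \<le> of_int m * (2 + X)" using cd y1 by (simp add: abs_mult algebra_simps)
    hence a: "\<bar>a\<bar> \<le> k" unfolding k_def by linarith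
    have "\<bar>b\<bar> * 1 \<le> \<bar>b\<bar> * c" using c by (intro mult_left_mono) auto
    also have "\<dots> = \<bar>b * c\<bar>" using c by (simp add: abs_mult)
    also have "b * c = a * d - 1" using det by simp
    also have "\<bar>a * d - 1\<bar> \<le> \<bar>a\<bar> * \<bar>d\<bar> + 1" by (simp flip: abs_mult)
    also have "\<bar>a\<bar> * \<bar>d\<bar> \<le> k * m" using a cd by (intro mult_mono) auto
    finally show "g \<in> G" using a cd g c by (auto simp: G_def geq)
  qed
qed

section \<open>The sum over tiles and its jumps across walls\<close>

definition tile_sum :: "real \<Rightarrow> real \<Rightarrow> real" where
  "tile_sum x y = (\<Sum>g | g \<in> SL2_pos \<and> tile_weight g x y \<noteq> 0. tile_weight g x y)"

lemma tile_sum_eq_sum: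
  assumes "finite G" "G \<subseteq> SL2_pos" "\<And>g. g \<in> SL2_pos \<Longrightarrow> tile_weight g x y \<noteq> 0 \<Longrightarrow> g \<in> G"
  shows "tile_sum x y = sum (\<lambda>g. tile_weight g x y) G"
  unfolding tile_sum_def using assms by (intro sum.mono_neutral_left) auto

text \<open>At a corner A = a y + c x and B = b y + d x are integers, and determinant 1 gives x = a
  B - b A.\<close>

lemma corner_imp_Ints:
  assumes "g \<in> SL2_pos" "slack_bottom g x y = 0" "slack_right g x y = 0 \<or> slack_left g x y = 0"
  shows "x \<in> \<int>"
proof -
  obtain a b c d where g: "g = (a,b,c,d)" by (cases g)
  obtain e :: int where e: "of_int a * y + of_int c * x = of_int e" and b: "of_int b * y + of_int d * x = - of_int c"
    using assms(2,3) g by (elim disjE; force intro: that[of "c+d"] that[of "d-c"])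
  have *: "real_of_int a * of_int d - of_int b * of_int c = 1"
    using assms(1) by (auto simp: g SL2_pos_def simp flip: of_int_mult of_int_diff)
  have "x = (of_int a * of_int d - of_int b * of_int c) * x" using * by simp
  also have "\<dots> = of_int a * (of_int b * y + of_int d * x) - of_int b * (of_int a * y + of_int c * x)"
    by (simp add: algebra_simps)
  also have "\<dots> \<in> \<int>" unfolding e b by simp
  finally show "x \<in> \<int>" .
qed

definition right_wall where "right_wall x y = {g \<in> SL2_pos. slack_right g x y = 0 \<and> slack_bottom g x y > 0}"
definition left_wall where "left_wall x y = {g \<in> SL2_pos. slack_left g x y = 0 \<and> slack_bottom g x y > 0}"
definition bottom_wall where "bottom_wall x y = {g \<in> SL2_pos. slack_bottom g x y = 0 \<and> slack_right g x y > 0 \<and> slack_left g x y > 0}"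

lemma slack_right_plus_left: "g \<in> SL2_pos \<Longrightarrow> slack_right g x y + slack_left g x y > 0"
  by (cases g) (auto simp: SL2_pos_def)

fun entry_a entry_b entry_d :: "quad \<Rightarrow> int" where
  "entry_a (a,b,c,d) = a" | "entry_b (a,b,c,d) = b" | "entry_d (a,b,c,d) = d"

lemma walls_pairing:
  assumes x: "x \<notin> \<int>" and fin: "finite (right_wall x y)" "finite (left_wall x y)" "finite (bottom_wall x y)"
  shows "(\<Sum>g\<in>left_wall x y. sgn (entry_a g)) - (\<Sum>g\<in>right_wall x y. sgn (entry_a g)) - (\<Sum>g\<in>bottom_wall x y. sgn (entry_b g)) =
    int (card {g \<in> bottom_wall x y. entry_d g = 0})"
proof -
  \<comment> \<open>A right wall is shared with the left wall of \<open>g T\<^sup>2\<close> or with the bottom wall of \<open>g T S\<close>,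
    according to the sign of \<open>tR\<close>, and left walls are symmetric. Bottom walls with \<open>d = 0\<close> stay
    unmatched; they lie on the line \<open>y = 1\<close>.\<close>
  define tR where "tR = (\<lambda>(a,b,c,d). 2 * (of_int a * y + of_int c * x) + (of_int b * y + of_int d * x) + real_of_int c)"
  define tL where "tL = (\<lambda>(a,b,c,d). (of_int b * y + of_int d * x) + real_of_int c - (of_int a * y + of_int c * x) - (of_int a * y + of_int c * x))"
  \<comment> \<open>With T = (1, 1; 0, 1) and S = (0, -1; 1, 0), \<open>tR g\<close> is minus the
    bottom slack of g T^2 and, on the right wall of \<open>g\<close>, equals the left slack of g T
    S. Its sign thus selects the neighbour, and its vanishing would mean a corner.\<close>
  have tR0: "tR g \<noteq> 0" if "g \<in> right_wall x y" for g
  proof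
    assume t: "tR g = 0"
    obtain a b c d where g: "g = (a,b,c,d)" by (cases g)
    have "(a, b+2*a, c, d+2*c) \<in> SL2_pos" "slack_bottom (a, b+2*a, c, d+2*c) x y = 0" "slack_left (a, b+2*a, c, d+2*c) x y = 0"
      using that t by (auto simp: right_wall_def g tR_def SL2_pos_def algebra_simps)
    thus False using corner_imp_Ints x by blast
  qed
  have tL0: "tL g \<noteq> 0" if "g \<in> left_wall x y" for g
  proof
    assume t: "tL g = 0"
    obtain a b c d where g: "g = (a,b,c,d)" by (cases g)
    have "(a, b-2*a, c, d-2*c) \<in> SL2_pos" "slack_bottom (a, b-2*a, c, d-2*c) x y = 0" "slack_right (a, b-2*a, c, d-2*c) x y = 0"
      using that t by (auto simp: left_wall_def g tL_def SL2_pos_def algebra_simps)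
    thus False using corner_imp_Ints x by blast
  qed
  have split: "(\<Sum>g\<in>S. f g) = (\<Sum>g | g \<in> S \<and> t g < 0. f g) + (\<Sum>g | g \<in> S \<and> t g > 0. f g)"
    if "finite S" "\<And>g. g \<in> S \<Longrightarrow> t g \<noteq> 0" for S and t :: "quad \<Rightarrow> real" and f :: "quad \<Rightarrow> int"
  proof -
    have "S = {g \<in> S. t g < 0} \<union> {g \<in> S. t g > 0}" using that(2) by (auto simp: neq_iff)
    thus ?thesis using that(1) by (metis (no_types, lifting) sum.union_disjoint finite_Un disjoint_iff mem_Collect_eq less_asym)
  qed
  \<comment> \<open>T^2 keeps \<open>entry_a\<close>, and right and left walls enter the total with
    opposite signs, so these terms cancel.\<close>
  have p1: "(\<Sum>g | g \<in> right_wall x y \<and> tR g < 0. sgn (entry_a g)) = (\<Sum>g | g \<in> left_wall x y \<and> tL g < 0. sgn (entry_a g))"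
    by (rule sum.reindex_bij_witness[of _ "\<lambda>(a,b,c,d). (a,b-2*a,c,d-2*c)" "\<lambda>(a,b,c,d). (a,b+2*a,c,d+2*c)"])
       (auto simp: right_wall_def left_wall_def tR_def tL_def SL2_pos_def algebra_simps)
  \<comment> \<open>The bottom slack of g T S is minus the right slack of \<open>g\<close>. The
    inverse map has lower left entry -d, which is why exactly the bottom walls with d < 0 are
    reached.\<close>
  have p2: "(\<Sum>g | g \<in> right_wall x y \<and> tR g > 0. sgn (entry_a g)) = (\<Sum>g | g \<in> bottom_wall x y \<and> entry_d g < 0. - sgn (entry_b g))"
  proof (rule sum.reindex_bij_witness[of _ "\<lambda>(a,b,c,d). (-b,a+b,-d,c+d)" "\<lambda>(a,b,c,d). (a+b,-a,c+d,-c)"], goal_cases)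
    case (2 g)
    obtain a b c d where g: "g = (a,b,c,d)" by (cases g)
    have h: "of_int c + of_int d - (of_int a * y + of_int c * x) = 0"
       "- (of_int b * y + of_int d * x) - of_int c > 0" "a * d - b * c = 1" "c > 0"
       "2 * (of_int a * y + of_int c * x) + (of_int b * y + of_int d * x) + real_of_int c > 0"
      using 2 by (simp_all add: g right_wall_def tR_def SL2_pos_def)
    have "real_of_int (c + d) > 0" using h by simp
    hence "c + d > 0" by linarith
    hence "(a+b,-a,c+d,-c) \<in> SL2_pos" using h(3) by (simp add: SL2_pos_def algebra_simps)
    moreover have "slack_bottom (a+b,-a,c+d,-c) x y = 0" "slack_right (a+b,-a,c+d,-c) x y > 0"
      unfolding slack_right.simps slack_bottom.simps of_int_add of_int_minus distrib_right using h by linarith+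
    moreover have "slack_left (a+b,-a,c+d,-c) x y > 0"
      unfolding slack_left.simps of_int_add of_int_minus distrib_right using h(1) h(5)[unfolded mult_2] by linarith
    ultimately show ?case using h(4) by (simp add: bottom_wall_def g)
  qed (auto simp: right_wall_def bottom_wall_def tR_def SL2_pos_def algebra_simps)
  \<comment> \<open>The mirror image: g T^-1 S up to sign, reaching the bottom walls with d >
    0.\<close>
  have p3: "(\<Sum>g | g \<in> left_wall x y \<and> tL g > 0. sgn (entry_a g)) = (\<Sum>g | g \<in> bottom_wall x y \<and> entry_d g > 0. sgn (entry_b g))"
  proof (rule sum.reindex_bij_witness[of _ "\<lambda>(a,b,c,d). (b,b-a,d,d-c)" "\<lambda>(a,b,c,d). (a-b,a,c-d,c)"], goal_cases)
    case (2 g)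
    obtain a b c d where g: "g = (a,b,c,d)" by (cases g)
    have h: "of_int c - of_int d + (of_int a * y + of_int c * x) = 0"
       "- (of_int b * y + of_int d * x) - of_int c > 0" "a * d - b * c = 1" "c > 0"
       "(of_int b * y + of_int d * x) + real_of_int c - (of_int a * y + of_int c * x) - (of_int a * y + of_int c * x) > 0"
      using 2 unfolding g left_wall_def tL_def SL2_pos_def mem_Collect_eq prod.case slack_left.simps slack_bottom.simps by blast+
    have "real_of_int (c - d) > 0" unfolding of_int_diff using h(1,2,5) by linarith
    hence "c - d > 0" by linarith
    hence "(a-b,a,c-d,c) \<in> SL2_pos" using h(3) by (simp add: SL2_pos_def algebra_simps)
    moreover have "slack_bottom (a-b,a,c-d,c) x y = 0" "slack_right (a-b,a,c-d,c) x y > 0" "slack_left (a-b,a,c-d,c) x y > 0"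
      unfolding slack_right.simps slack_left.simps slack_bottom.simps of_int_diff left_diff_distrib using h by linarith+
    ultimately show ?case using h(4) by (simp add: bottom_wall_def g)
  qed (auto simp: left_wall_def bottom_wall_def tL_def SL2_pos_def algebra_simps)
  have B: "bottom_wall x y = {g \<in> bottom_wall x y. entry_d g < 0} \<union> ({g \<in> bottom_wall x y. entry_d g > 0} \<union> {g \<in> bottom_wall x y. entry_d g = 0})" by auto
  have "(\<Sum>g\<in>bottom_wall x y. sgn (entry_b g)) = (\<Sum>g | g \<in> bottom_wall x y \<and> entry_d g < 0. sgn (entry_b g)) +
     ((\<Sum>g | g \<in> bottom_wall x y \<and> entry_d g > 0. sgn (entry_b g)) + (\<Sum>g | g \<in> bottom_wall x y \<and> entry_d g = 0. sgn (entry_b g)))"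
    by (subst B, subst sum.union_disjoint, use fin in force, use fin in force, force,
        subst sum.union_disjoint, use fin in force, use fin in force, force, rule refl)
  moreover have "(\<Sum>g | g \<in> bottom_wall x y \<and> entry_d g = 0. sgn (entry_b g)) = (\<Sum>g | g \<in> bottom_wall x y \<and> entry_d g = 0. -1)"
  proof (rule sum.cong[OF refl])
    fix g assume g: "g \<in> {g \<in> bottom_wall x y. entry_d g = 0}"
    obtain a b c d where geq: "g = (a,b,c,d)" by (cases g)
    have "- (b * c) = 1" "c > 0" using g by (auto simp: geq bottom_wall_def SL2_pos_def)
    hence "b < 0" by (smt (verit) mult_nonneg_nonneg)
    thus "sgn (entry_b g) = - 1" by (simp add: geq)
  qed
  ultimately show ?thesis
    using split[OF fin(1) tR0, where f = "\<lambda>g. sgn (entry_a g)"] split[OF fin(2) tL0, where f = "\<lambda>g. sgn (entry_a g)"] p1 p2 p3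
    by (simp add: sum_negf)
qed

lemma card_bottom_wall_d0:
  assumes "x \<notin> \<int>"
  shows "card {g \<in> bottom_wall x y. entry_d g = 0} = (if y = 1 then 2 else 0)"
proof -
  have eq: "{g \<in> bottom_wall x y. entry_d g = 0} = (if y = 1 then (\<lambda>a. (a,-1,1,0)) ` {\<lfloor>-x\<rfloor>, \<lfloor>-x\<rfloor> + 1} else {})"
  proof -
    have 1: "c = 1 \<and> b = -1" if "- (b * c) = 1" "c > 0" for b c :: int
    proof -
      have "c dvd 1" using that(1) by (metis dvd_minus_iff dvd_triv_right)
      thus ?thesis using that by auto
    qed
    \<comment> \<open>The open interval of length 2 around -x contains exactly two integers because
      -x is not one itself.\<close>
    have 2: "real_of_int a + x < 1 \<and> - 1 < of_int a + x \<longleftrightarrow> a = \<lfloor>-x\<rfloor> \<or> a = \<lfloor>-x\<rfloor> + 1" for a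
    proof -
      have "of_int \<lfloor>-x\<rfloor> \<noteq> - x" using assms by (metis Ints_minus Ints_of_int minus_minus)
      thus ?thesis by linarith
    qed
    have 3: "(a,b,c,d) \<in> bottom_wall x y \<and> d = 0 \<longleftrightarrow>
        b = -1 \<and> c = 1 \<and> d = 0 \<and> y = 1 \<and> of_int a + x < 1 \<and> - 1 < of_int a + x" for a b c d
      using 1[of b c] by (auto simp: bottom_wall_def SL2_pos_def)
    have "{g \<in> bottom_wall x y. entry_d g = 0} = {(a,b,c,d). (a,b,c,d) \<in> bottom_wall x y \<and> d = 0}" by auto
    thus ?thesis unfolding 3 2 by auto
  qed
  show ?thesis unfolding eq by (auto simp: card_image inj_on_def)
qed

lemma sgn_of_int: "sgn (real_of_int k) = of_int (sgn k)"
  by (simp add: sgn_if)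

text \<open>As y grows, the slacks of \<open>g\<close> have slopes -a, a, -b, so the jumps add up to
  half the signed wall count of \<open>walls_pairing\<close>. On y = 1 this is 2/2 = 1, exactly the
  coefficient of \<open>sgn h\<close> in \<open>sgn (y + h - 1)\<close>; elsewhere it is 0.\<close>

lemma tile_sum_minus_sgn_locally_constant:
  assumes x: "x \<notin> \<int>"
  shows "\<forall>\<^sub>F h in nhds 0. tile_sum x (y + h) - sgn (y + h - 1) = tile_sum x y - sgn (y - 1)"
proof -
  obtain G where G: "finite G" "G \<subseteq> SL2_pos"
    "\<And>g y'. g \<in> SL2_pos \<Longrightarrow> y' \<le> y + 1 \<Longrightarrow> tile_weight g x y' \<noteq> 0 \<Longrightarrow> g \<in> G"
    using finite_support[of "\<bar>x\<bar>" "y+1"] by (metis order_refl)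
  define J where "J = (\<lambda>g. domain_weight_jump (slack_right g x y) (slack_left g x y) (slack_bottom g x y) (- of_int (entry_a g)) (of_int (entry_a g)) (- of_int (entry_b g)))"
  have walls: "right_wall x y \<subseteq> G" "left_wall x y \<subseteq> G" "bottom_wall x y \<subseteq> G"
    using G(3)[of _ y] slack_right_plus_left[of _ x y] by (fastforce simp: right_wall_def left_wall_def bottom_wall_def tile_weight_def domain_weight_def)+
  have fin: "finite (right_wall x y)" "finite (left_wall x y)" "finite (bottom_wall x y)"
    using walls G(1) finite_subset by blast+
  have ev1: "\<forall>\<^sub>F h in nhds 0. \<forall>g\<in>G. tile_weight g x (y + h) = tile_weight g x y + sgn h * J g"
  proof (intro eventually_ball_finite G(1) ballI)
    fix g assume g: "g \<in> G"
    obtain a b c d where geq: "g = (a,b,c,d)" by (cases g)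
    have eq: "slack_right g x (y + h) = slack_right g x y + (- of_int (entry_a g)) * h" "slack_left g x (y + h) = slack_left g x y + of_int (entry_a g) * h"
       "slack_bottom g x (y + h) = slack_bottom g x y + (- of_int (entry_b g)) * h" for h
      by (auto simp: geq algebra_simps)
    show "\<forall>\<^sub>F h in nhds 0. tile_weight g x (y + h) = tile_weight g x y + sgn h * J g"
      unfolding tile_weight_def J_def eq using corner_imp_Ints[of g x y] g G(2) x
      by (intro eventually_domain_weight_affine slack_right_plus_left) blast+
  qed
  have "2 * (\<Sum>g\<in>G. J g) = (\<Sum>g\<in>G. (if g \<in> right_wall x y then - sgn (of_int (entry_a g)) else 0) +
     (if g \<in> left_wall x y then sgn (of_int (entry_a g)) else 0) + (if g \<in> bottom_wall x y then - sgn (of_int (entry_b g)) else 0))"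
    unfolding sum_distrib_left
    by (rule sum.cong) (use G(2) in \<open>auto simp: J_def domain_weight_jump_def right_wall_def left_wall_def bottom_wall_def sgn_minus\<close>)
  also have "\<dots> = (\<Sum>g\<in>right_wall x y. - sgn (of_int (entry_a g))) + (\<Sum>g\<in>left_wall x y. sgn (of_int (entry_a g)))
      + (\<Sum>g\<in>bottom_wall x y. - sgn (of_int (entry_b g)))"
    using walls by (simp add: sum.distrib sum.inter_restrict[OF G(1), symmetric] Int_absorb1)
  also have "\<dots> = real_of_int ((\<Sum>g\<in>left_wall x y. sgn (entry_a g)) - (\<Sum>g\<in>right_wall x y. sgn (entry_a g)) - (\<Sum>g\<in>bottom_wall x y. sgn (entry_b g)))"
    by (simp add: sum_negf sgn_of_int)
  also have "\<dots> = (if y = 1 then 2 else 0)"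
    unfolding walls_pairing[OF x fin] card_bottom_wall_d0[OF x] by simp
  finally have J: "(\<Sum>g\<in>G. J g) = (if y = 1 then 1 else 0)" by (simp split: if_splits)
  have ev2: "\<forall>\<^sub>F h in nhds 0. h < (1::real)"
    by (intro order_tendstoD[of "\<lambda>h. h" 0]) (auto simp: tendsto_ident_at filterlim_ident)
  have ev3: "\<forall>\<^sub>F h in nhds 0. sgn (y - 1 + 1 * h) = (if y - 1 = 0 then sgn 1 * sgn h else sgn (y - 1))"
    by (rule eventually_sgn_affine)
  show ?thesis using ev1 ev2 ev3
  proof eventually_elim
    case (elim h)
    have "tile_sum x (y + h) = (\<Sum>g\<in>G. tile_weight g x (y + h))" using G(1,2) G(3)[of _ "y + h"] elim(2) by (intro tile_sum_eq_sum) simp_all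
    also have "\<dots> = (\<Sum>g\<in>G. tile_weight g x y) + sgn h * (\<Sum>g\<in>G. J g)"
      using elim(1) by (simp add: sum.distrib sum_distrib_left)
    also have "(\<Sum>g\<in>G. tile_weight g x y) = tile_sum x y" using G(1,2) G(3)[of _ y] by (intro tile_sum_eq_sum[symmetric]) simp_all
    finally have "tile_sum x (y + h) = tile_sum x y + sgn h * (\<Sum>g\<in>G. J g)" .
    moreover have "sgn (y + h - 1) = sgn (y - 1 + 1 * h)" by (simp add: algebra_simps)
    ultimately show ?case unfolding elim(3) J by simp
  qed
qed

text \<open>Local constancy on the connected real line gives one constant, read off at y = 0, below
  all tiles.\<close>

lemma tile_sum_nonint:
  assumes x: "x \<notin> \<int>"
  shows "tile_sum x y = 1 + sgn (y - 1)"
proof -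
  define F where "F = (\<lambda>y. tile_sum x y - sgn (y - 1))"
  have loc: "\<forall>\<^sub>F z in nhds y. F z = F y" for y
  proof -
    have "filterlim (\<lambda>z. z - y) (nhds 0) (nhds y)"
      using tendsto_diff[OF filterlim_ident tendsto_const, of y y] by simp
    from eventually_compose_filterlim[OF tile_sum_minus_sgn_locally_constant[OF x, of y] this]
    show ?thesis by (simp add: F_def algebra_simps)
  qed
  have "F constant_on UNIV"
  proof (rule locally_constant_imp_constant)
    fix y :: real
    from loc[of y] obtain S where "open S" "y \<in> S" "\<forall>z\<in>S. F z = F y"
      unfolding eventually_nhds by blast
    thus "\<exists>S. openin (top_of_set UNIV) S \<and> y \<in> S \<and> (\<forall>z\<in>S. F z = F y)"
      by (metis open_openin subtopology_UNIV)
  qed simp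
  hence "F y = F 0" unfolding constant_on_def by auto
  moreover have "tile_sum x 0 = 0" unfolding tile_sum_def by (intro sum.neutral) (auto simp: tile_weight_eq_0_of_less_1)
  ultimately show ?thesis by (simp add: F_def)
qed

section \<open>Vertices and integral x\<close>

definition right_corner where "right_corner x y = {g \<in> SL2_pos. slack_bottom g x y = 0 \<and> slack_right g x y = 0}"
definition left_corner where "left_corner x y = {g \<in> SL2_pos. slack_bottom g x y = 0 \<and> slack_left g x y = 0}"

text \<open>Here A = c + d and B = -c in y = d A - c B. The value is |c rho + d|^2 with rho = e^(i
  pi/3), the fixed point at this corner.\<close>

lemma corner_form:
  assumes "(a,b,c,d) \<in> right_corner x y"
  shows "y = of_int (c\<^sup>2 + c * d + d\<^sup>2)"
proof -
  have *: "real_of_int a * of_int d - of_int b * of_int c = 1"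
    using assms by (auto simp: right_corner_def SL2_pos_def simp flip: of_int_mult of_int_diff)
  have e: "of_int a * y + of_int c * x = of_int c + of_int d" "of_int b * y + of_int d * x = - of_int c"
    using assms by (auto simp: right_corner_def)
  have "y = (of_int a * of_int d - of_int b * of_int c) * y" using * by simp
  also have "\<dots> = of_int d * (of_int a * y + of_int c * x) - of_int c * (of_int b * y + of_int d * x)"
    by (simp add: algebra_simps)
  finally show ?thesis unfolding e by (simp add: power2_eq_square algebra_simps)
qed

text \<open>If d or c + d vanishes, determinant 1 makes c a unit, and \<open>corner_form\<close>
  yields y = 1. Otherwise the lower left entries c, c + d, d of a triple all have a definite
  sign.\<close>

lemma corner_nondegenerate:
  assumes g: "(a,b,c,d) \<in> right_corner x y" and y: "y \<noteq> 1"
  shows "d \<noteq> 0" "c + d \<noteq> 0"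
proof -
  have det: "a * d - b * c = 1" "c > 0" using g by (auto simp: right_corner_def SL2_pos_def)
  show "d \<noteq> 0"
  proof
    assume d: "d = 0"
    hence "c dvd 1" using det by (metis dvd_diff dvd_triv_right mult_zero_right dvd_0_right)
    thus False using corner_form[OF g] d det y by auto
  qed
  show "c + d \<noteq> 0"
  proof
    assume "c + d = 0"
    hence d: "d = - c" by simp
    hence "c * (- a - b) = 1" using det by (simp add: algebra_simps)
    hence "c dvd 1" by (metis dvd_triv_left)
    thus False using corner_form[OF g] d det y by auto
  qed
qed

text \<open>These are g T S and g (T S)^-1, where T S has order 3 in PSL(2, Z) and fixes e^(i pi/3).
  The sign conditions say that the image as written has positive lower left entry.\<close>

lemma right_corner_rotate:
  assumes "(a,b,c,d) \<in> right_corner x y"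
  shows "c + d > 0 \<Longrightarrow> (a+b,-a,c+d,-c) \<in> right_corner x y" "d < 0 \<Longrightarrow> (-b,a+b,-d,c+d) \<in> right_corner x y"
proof -
  have h: "of_int c + of_int d - (of_int a * y + of_int c * x) = 0"
     "- (of_int b * y + of_int d * x) - of_int c = 0" "a * d - b * c = 1"
    using assms by (simp_all add: right_corner_def SL2_pos_def)
  have "slack_bottom (a+b,-a,c+d,-c) x y = 0" "slack_right (a+b,-a,c+d,-c) x y = 0"
       "slack_bottom (-b,a+b,-d,c+d) x y = 0" "slack_right (-b,a+b,-d,c+d) x y = 0"
    unfolding slack_right.simps slack_bottom.simps of_int_add of_int_minus distrib_right using h(1,2) by linarith+
  thus "c + d > 0 \<Longrightarrow> (a+b,-a,c+d,-c) \<in> right_corner x y" "d < 0 \<Longrightarrow> (-b,a+b,-d,c+d) \<in> right_corner x y"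
    using h(3) by (simp_all add: right_corner_def SL2_pos_def algebra_simps)
qed

text \<open>The element of order 3 fixing the corner permutes the tiles meeting there in triples; a horizontal
  line through the corner enters exactly one tile of each triple.\<close>

lemma sum_right_corner:
  assumes y: "y \<noteq> 1" and fin: "finite (right_corner x y)"
  shows "(\<Sum>g\<in>right_corner x y. (if entry_d g > 0 then 1 else 0) - 1/3 :: real) = 0"
proof -
  define gs :: "quad \<Rightarrow> int" where "gs = (\<lambda>(a,b,c,d). c + d)"
  \<comment> \<open>Since c > 0, the signs of d and c + d leave three patterns, and right
    multiplication by T S maps \<open>C1\<close> to \<open>C2\<close> and \<open>C2\<close> to
    \<open>C3\<close>. So one element in three has d > 0, which the 1/3 in the summand
    balances.\<close>
  define C1 where "C1 = {g \<in> right_corner x y. entry_d g > 0}"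
  define C2 where "C2 = {g \<in> right_corner x y. entry_d g < 0 \<and> gs g > 0}"
  define C3 where "C3 = {g \<in> right_corner x y. entry_d g < 0 \<and> gs g < 0}"
  have pos: "c > 0" if "(a,b,c,d) \<in> right_corner x y" for a b c d using that by (simp add: right_corner_def SL2_pos_def)
  have 1: "bij_betw (\<lambda>(a,b,c,d). (a+b,-a,c+d,-c)) C1 C2"
    by (rule bij_betw_byWitness[of _ "\<lambda>(a,b,c,d). (-b,a+b,-d,c+d)"])
       (auto simp: C1_def C2_def gs_def dest: pos intro!: right_corner_rotate)
  have 2: "bij_betw (\<lambda>(a,b,c,d). (a+b,-a,c+d,-c)) C2 C3"
    by (rule bij_betw_byWitness[of _ "\<lambda>(a,b,c,d). (-b,a+b,-d,c+d)"])
       (auto simp: C2_def C3_def gs_def dest: pos intro!: right_corner_rotate)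
  have U: "right_corner x y = C1 \<union> (C2 \<union> C3)"
    using corner_nondegenerate[OF _ y, of _ _ _ _ x] by (fastforce simp: C1_def C2_def C3_def gs_def)
  have fin': "finite C1" "finite C2" "finite C3" using fin U by auto
  have "card (right_corner x y) = card C1 + (card C2 + card C3)"
    unfolding U using fin' by (subst card_Un_disjoint; (subst card_Un_disjoint)?; auto simp: C1_def C2_def C3_def)
  also have "\<dots> = 3 * card C1" using bij_betw_same_card[OF 1] bij_betw_same_card[OF 2] by simp
  finally have "real (card (right_corner x y)) = 3 * real (card C1)" by simp
  moreover have "(\<Sum>g\<in>right_corner x y. (if entry_d g > 0 then 1 else 0 :: real)) = card C1"
    using fin by (simp add: sum.If_cases C1_def Int_def)
  ultimately show ?thesis by (simp add: sum_subtractf)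
qed

text \<open>Conjugation by diag(-1, 1), up to sign; it reflects the tiles in the line x = 0.\<close>

lemma left_corner_reflect: "bij_betw (\<lambda>(a,b,c,d). (-a,b,c,-d)) (left_corner x y) (right_corner (-x) y)"
  by (rule bij_betw_byWitness[of _ "\<lambda>(a,b,c,d). (-a,b,c,-d)"])
     (auto simp: left_corner_def right_corner_def SL2_pos_def)

lemma sum_left_corner:
  assumes y: "y \<noteq> 1" and fin: "finite (left_corner x y)"
  shows "(\<Sum>g\<in>left_corner x y. (if entry_d g < 0 then 1 else 0) - 1/3 :: real) = 0"
proof -
  have "(\<Sum>g\<in>left_corner x y. (if entry_d g < 0 then 1 else 0) - 1/3 :: real) =
        (\<Sum>g\<in>right_corner (-x) y. (if entry_d g > 0 then 1 else 0) - 1/3)"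
    by (subst sum.reindex_bij_betw[OF left_corner_reflect, symmetric]) (auto intro!: sum.cong)
  thus ?thesis using sum_right_corner[OF y, of "-x"] bij_betw_finite[OF left_corner_reflect] fin by simp
qed

text \<open>For a tile without a corner at the point, the weight is the mean of the weights at x +-
  h, as the jump is odd in h. Only corner tiles deviate, and their deviations cancel within the
  triples.\<close>

lemma tile_sum_int:
  assumes y: "y \<noteq> 1" and x: "x \<in> \<int>"
  shows "tile_sum x y = 1 + sgn (y - 1)"
proof -
  obtain G where G: "finite G" "G \<subseteq> SL2_pos"
    "\<And>g x'. g \<in> SL2_pos \<Longrightarrow> \<bar>x'\<bar> \<le> \<bar>x\<bar> + 1 \<Longrightarrow> tile_weight g x' y \<noteq> 0 \<Longrightarrow> g \<in> G"
    using finite_support[of "\<bar>x\<bar>+1" y] by (metis order_refl)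
  have sub: "right_corner x y \<subseteq> G" "left_corner x y \<subseteq> G"
    using G(3)[of _ x] slack_right_plus_left[of _ x y] by (fastforce simp: right_corner_def left_corner_def tile_weight_def domain_weight_def)+
  have fin: "finite (right_corner x y)" "finite (left_corner x y)"
    using sub G(1) finite_subset by blast+
  \<comment> \<open>The second difference of the weight at a corner: twice 1/6 is lost, and 1 is
    gained if the tile is entered. At a right corner x + h violates the right wall, while at x - h
    the bottom slack is d h, so entry means d > 0; left corners are symmetric.\<close>
  define E where "E = (\<lambda>g. (if g \<in> right_corner x y then (if entry_d g > 0 then 1 else 0) - 1/3 else 0) +
       (if g \<in> left_corner x y then (if entry_d g < 0 then 1 else 0) - 1/3 else 0 :: real))"
  have E: "(\<Sum>g\<in>G. E g) = 0"
    using sub sum_right_corner[OF y fin(1)] sum_left_corner[OF y fin(2)]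
    by (simp add: E_def sum.distrib sum.inter_restrict[OF G(1), symmetric] Int_absorb1)
  have ev1: "\<forall>\<^sub>F h in nhds 0. \<forall>g\<in>G. 0 < h \<longrightarrow> tile_weight g (x + h) y + tile_weight g (x + - h) y = 2 * tile_weight g x y + E g"
  proof (intro eventually_ball_finite G(1) ballI)
    fix g assume gG: "g \<in> G"
    hence g: "g \<in> SL2_pos" using G(2) by blast
    obtain a b c d where geq: "g = (a,b,c,d)" by (cases g)
    have c: "c > 0" using g by (simp add: geq SL2_pos_def)
    define r l t where "r = slack_right g x y" and "l = slack_left g x y" and "t = slack_bottom g x y"
    have eq: "tile_weight g (x + h) y = domain_weight (r + (- of_int c) * h) (l + of_int c * h) (t + (- of_int d) * h)" for h
      by (simp add: tile_weight_def geq r_def l_def t_def algebra_simps)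
    have rl: "r + l > 0" using slack_right_plus_left[OF g] by (simp add: r_def l_def)
    show "\<forall>\<^sub>F h in nhds 0. 0 < h \<longrightarrow> tile_weight g (x + h) y + tile_weight g (x + - h) y = 2 * tile_weight g x y + E g"
    proof (cases "t = 0 \<and> (r = 0 \<or> l = 0)")
      case False
      have E0: "E g = 0" using False by (auto simp: E_def right_corner_def left_corner_def r_def l_def t_def)
      have 1: "\<forall>\<^sub>F h in nhds 0. domain_weight (r + (- of_int c) * h) (l + of_int c * h) (t + (- of_int d) * h) =
         domain_weight r l t + sgn h * domain_weight_jump r l t (- of_int c) (of_int c) (- of_int d)"
        by (rule eventually_domain_weight_affine[OF rl False])
      have 2: "\<forall>\<^sub>F h in nhds 0. domain_weight (r + (- of_int c) * (- h)) (l + of_int c * (- h)) (t + (- of_int d) * (- h)) =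
         domain_weight r l t + sgn (- h) * domain_weight_jump r l t (- of_int c) (of_int c) (- of_int d)"
        by (rule eventually_compose_filterlim[OF 1]) (use tendsto_minus[OF filterlim_ident, of "0::real"] in simp)
      have W0: "tile_weight g x y = domain_weight r l t" by (simp add: tile_weight_def r_def l_def t_def)
      from 1 2 show ?thesis
      proof eventually_elim
        case (elim h)
        show ?case unfolding eq elim W0 E0 by (simp add: sgn_minus)
      qed
    next
      case True
      have d: "d \<noteq> 0"
      proof (cases "r = 0")
        case True': True
        hence "(a,b,c,d) \<in> right_corner x y" using True g by (simp add: right_corner_def r_def t_def geq)
        thus ?thesis using corner_nondegenerate(1)[OF _ y] by blast
      next
        case False
        hence "(a,b,c,d) \<in> left_corner x y" using True g by (simp add: left_corner_def l_def t_def geq)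
        hence "(-a,b,c,-d) \<in> right_corner (-x) y" using bij_betw_apply[OF left_corner_reflect] by force
        thus ?thesis using corner_nondegenerate(1)[OF _ y] by fastforce
      qed
      \<comment> \<open>Keeps the opposite side slack positive at distance h from the
        corner.\<close>
      have "\<forall>\<^sub>F h in nhds 0. 2 * of_int c * h < r + l"
        using rl by (intro order_tendstoD(2)[of _ "2 * of_int c * 0"] tendsto_intros filterlim_ident) simp
      thus ?thesis
      proof eventually_elim
        case (elim h)
        show ?case
        proof
          assume h: "h > 0"
          have ch: "of_int c * h > 0" using c h by simp
          have dh: "of_int d * h > 0 \<longleftrightarrow> d > 0" "of_int d * h \<noteq> 0"
            using h d by (auto simp: zero_less_mult_iff)
          have t: "t = 0" and W0: "tile_weight g x y = 1/6"
            using True rl by (auto simp: tile_weight_def r_def l_def t_def domain_weight_def)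
          have mem: "g \<in> right_corner x y \<longleftrightarrow> r = 0" "g \<in> left_corner x y \<longleftrightarrow> l = 0"
            using True g by (auto simp: right_corner_def left_corner_def r_def l_def t_def)
          show "tile_weight g (x + h) y + tile_weight g (x + - h) y = 2 * tile_weight g x y + E g"
          proof (cases "r = 0")
            case r: True
            have "tile_weight g (x + h) y = 0" unfolding eq using r ch by (simp add: domain_weight_def)
            moreover have "tile_weight g (x + - h) y = (if d > 0 then 1 else 0)"
              unfolding eq using r t ch dh elim by (auto simp: domain_weight_def)
            moreover have "E g = (if d > 0 then 1 else 0) - 1/3"
              using r rl by (simp add: E_def mem geq[symmetric]) (simp add: geq)
            ultimately show ?thesis by (simp add: W0)
          next
            case r: False
            hence l: "l = 0" using True by blast
            have "tile_weight g (x + - h) y = 0" unfolding eq using l ch by (simp add: domain_weight_def)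
            moreover have "tile_weight g (x + h) y = (if d < 0 then 1 else 0)"
              unfolding eq using l t ch dh elim d by (auto simp: domain_weight_def)
            moreover have "E g = (if d < 0 then 1 else 0) - 1/3"
              using l r by (simp add: E_def mem geq[symmetric]) (simp add: geq)
            ultimately show ?thesis by (simp add: W0)
          qed
        qed
      qed
    qed
  qed
  have ev2: "\<forall>\<^sub>F h in nhds 0. h < (1::real)"
    by (intro order_tendstoD[of "\<lambda>h. h" 0] filterlim_ident) simp
  have "\<forall>\<^sub>F h in at_right 0. 0 < h \<and> h < 1 \<and> (\<forall>g\<in>G. tile_weight g (x + h) y + tile_weight g (x + - h) y = 2 * tile_weight g x y + E g)"
    using ev1 ev2 unfolding eventually_at_filter by eventually_elim auto
  then obtain h where h: "0 < h" "h < 1" "\<And>g. g \<in> G \<Longrightarrow> tile_weight g (x + h) y + tile_weight g (x + - h) y = 2 * tile_weight g x y + E g"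
    using eventually_happens'[OF trivial_limit_at_right_real] by blast
  have "x + h \<notin> \<int>" "x + - h \<notin> \<int>"
  proof -
    obtain k where k: "x = of_int k" using x by (auto elim: Ints_cases)
    show "x + h \<notin> \<int>" "x + - h \<notin> \<int>" using h by (auto simp: k elim!: Ints_cases)
  qed
  hence "2 * (1 + sgn (y - 1)) = tile_sum (x + h) y + tile_sum (x + - h) y" by (simp add: tile_sum_nonint)
  also have "\<dots> = (\<Sum>g\<in>G. tile_weight g (x + h) y) + (\<Sum>g\<in>G. tile_weight g (x + - h) y)"
    using h(1,2) G(1,2) G(3)[of _ "x + h"] G(3)[of _ "x + - h"]
    by (intro arg_cong2[of _ _ _ _ "(+)"] tile_sum_eq_sum) simp_all
  also have "\<dots> = (\<Sum>g\<in>G. 2 * tile_weight g x y + E g)"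
    unfolding sum.distrib[symmetric] using h(3) by (intro sum.cong) auto
  also have "\<dots> = 2 * (\<Sum>g\<in>G. tile_weight g x y)"
    by (simp add: sum.distrib E sum_distrib_left)
  also have "(\<Sum>g\<in>G. tile_weight g x y) = tile_sum x y" using G(1,2) G(3)[of _ x] by (intro tile_sum_eq_sum[symmetric]) simp_all
  finally show ?thesis by simp
qed

text \<open>Here \<open>strip_bound\<close> holds with equality and the form is 1, so c = 1 and |d|
  <= 1. The point is inside the bottom edge of one tile and at a corner of four: 1/2 + 4/6.\<close>

lemma tile_sum_int_1: "tile_sum (of_int k) 1 = 7/6"
proof -
  define G :: "quad set" where "G = {(-k,-1,1,0), (1-k,-1,1,0), (-1-k,-1,1,0), (-k,-k-1,1,1), (-k,k-1,1,-1)}"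
  have "g \<in> G" if g: "g \<in> SL2_pos" and nz: "tile_weight g (of_int k) 1 \<noteq> 0" for g
  proof -
    obtain a b c d where geq: "g = (a,b,c,d)" by (cases g)
    have det: "a * d - b * c = 1" and c: "c > 0" using g by (auto simp: geq SL2_pos_def)
    note sb = tile_weight_nonzeroD[OF nz, unfolded geq]
    have "of_int (c\<^sup>2 - c * \<bar>d\<bar> + d\<^sup>2) \<le> (1::real)"
      using strip_bound(1)[OF _ sb] g unfolding geq by blast
    hence Q: "c\<^sup>2 - c * \<bar>d\<bar> + d\<^sup>2 = 1" using int_form_bounds(1)[OF c, of d] by linarith
    have "c \<le> 2" "\<bar>d\<bar> \<le> 2" using int_form_bounds(2,3)[OF c, of d] Q by auto
    hence "c \<in> {1,2}" "d \<in> {-2,-1,0,1,2}" using c by auto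
    hence cd: "c = 1 \<and> d \<in> {-1,0,1}" using Q by auto
    have corner: "slack_bottom (a,b,c,d) (of_int k) 1 = 0 \<and>
           (d \<noteq> 0 \<longrightarrow> slack_right (a,b,c,d) (of_int k) 1 = 0 \<or> slack_left (a,b,c,d) (of_int k) 1 = 0)"
      using strip_bound(2)[OF _ sb] g Q unfolding geq by simp
    have "real_of_int (- (b + d * k) - c) = 0" using corner by simp
    hence b: "b + d * k = - c" by linarith
    have "real_of_int (c + d - (a + c * k)) \<ge> 0" "real_of_int (c - d + (a + c * k)) \<ge> 0"
      using sb by simp_all
    hence "\<bar>a + c * k - d\<bar> \<le> c" by linarith
    hence a: "\<bar>a + k - d\<bar> \<le> 1" using cd by simp
    from cd consider "d = 0" | "d = 1" | "d = -1" by blast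
    thus ?thesis
    proof cases
      case 1
      hence "b = -1" "c = 1" using b cd by auto
      moreover have "a = -k \<or> a = 1 - k \<or> a = - 1 - k" using a 1 by linarith
      ultimately show ?thesis using 1 by (auto simp: G_def geq)
    next
      case 2
      hence "b = - k - 1" "c = 1" using b cd by auto
      moreover have "a = - k" using det 2 calculation by simp
      ultimately show ?thesis using 2 by (simp add: G_def geq)
    next
      case 3
      hence "b = k - 1" "c = 1" using b cd by auto
      moreover have "a = - k" using det 3 calculation by simp
      ultimately show ?thesis using 3 by (simp add: G_def geq)
    qed
  qed
  moreover have "G \<subseteq> SL2_pos" by (auto simp: G_def SL2_pos_def)
  ultimately have "tile_sum (of_int k) 1 = (\<Sum>g\<in>G. tile_weight g (of_int k) 1)" by (intro tile_sum_eq_sum) (auto simp: G_def)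
  also have "\<dots> = 7/6" by (simp add: G_def tile_weight_def domain_weight_def)
  finally show ?thesis .
qed

lemma tile_sum_eq: "tile_sum x y = 1 + sgn (y - 1) + (if y = 1 \<and> x \<in> \<int> then 1/6 else 0)"
proof (cases "x \<in> \<int>")
  case True
  then obtain k where "x = of_int k" by (rule Ints_cases)
  thus ?thesis using tile_sum_int[OF _ True] tile_sum_int_1[of k] by (cases "y = 1") simp_all
next
  case False
  thus ?thesis using tile_sum_nonint[OF False] by simp
qed

section \<open>The angle function\<close>

lemma borel_preimage_continuous:
  fixes f :: "'a::topological_space \<Rightarrow> 'b::topological_space"
  assumes "continuous_on UNIV f" "S \<in> sets borel"
  shows "{x. f x \<in> S} \<in> sets borel"
  using measurable_sets_borel[OF borel_measurable_continuous_onI[OF assms(1)] assms(2)]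
  by (simp add: vimage_def)

text \<open>Transport to \<open>real^2\<close>, where the measure of orthogonal images is available;
  Lebesgue measure is determined by its values on boxes.\<close>

lemma measure_complex_eq_vec2:
  fixes S :: "complex set"
  assumes "S \<in> sets borel"
  shows "measure lborel S = measure lborel {v :: real^2. Complex (v$1) (v$2) \<in> S}"
proof -
  have m: "(\<lambda>v::real^2. Complex (v$1) (v$2)) \<in> borel_measurable borel"
    by (intro borel_measurable_continuous_onI) (auto simp: Complex_eq intro!: continuous_intros)
  have Basis2: "Basis = {axis 1 1, axis 2 1 :: real^2}" and ax: "axis 1 1 \<noteq> (axis 2 1 :: real^2)"
    by (auto simp: Basis_vec_def axis_eq_axis) (metis exhaust_2)
  have "lborel = distr lborel borel (\<lambda>v::real^2. Complex (v$1) (v$2))"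
  proof (rule lborel_eqI)
    fix l u :: complex assume le: "\<And>b. b \<in> Basis \<Longrightarrow> l \<bullet> b \<le> u \<bullet> b"
    have "(\<lambda>v::real^2. Complex (v$1) (v$2)) -` box l u = box (vector [Re l, Im l]) (vector [Re u, Im u])"
      by (auto simp: in_box_complex_iff mem_box_cart forall_2)
    thus "emeasure (distr lborel borel (\<lambda>v::real^2. Complex (v$1) (v$2))) (box l u) = (\<Prod>b\<in>Basis. (u - l) \<bullet> b)"
      using le[of 1] le[of \<i>] m
      by (simp add: emeasure_distr emeasure_lborel_box_eq Basis_complex_def Basis2 ax inner_axis algebra_simps)
  qed simp
  hence "measure lborel S = measure (distr lborel borel (\<lambda>v::real^2. Complex (v$1) (v$2))) S" by simp
  also have "\<dots> = measure lborel {v :: real^2. Complex (v$1) (v$2) \<in> S}"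
    using m assms by (subst measure_distr) (auto simp: vimage_def)
  finally show ?thesis .
qed

lemma measure_complex_rotate:
  fixes S :: "complex set"
  assumes w: "cmod w = 1" and S: "S \<in> sets borel" "bounded S"
  shows "measure lborel {z. w * z \<in> S} = measure lborel S"
proof -
  define f where "f = (\<lambda>v::real^2. vector [Re w * v$1 - Im w * v$2, Im w * v$1 + Re w * v$2] :: real^2)"
  define T where "T = (\<lambda>S. {v :: real^2. Complex (v$1) (v$2) \<in> S})"
  have w2: "(Re w)\<^sup>2 + (Im w)\<^sup>2 = 1" using w by (simp add: cmod_def)
  have "linear f"
    by (rule linearI) (auto simp: f_def vec_eq_iff forall_2 algebra_simps)
  have "norm (f v) = norm v" for v
  proof -
    have "(Re w * v$1 - Im w * v$2)\<^sup>2 + (Im w * v$1 + Re w * v$2)\<^sup>2 = ((Re w)\<^sup>2 + (Im w)\<^sup>2) * ((v$1)\<^sup>2 + (v$2)\<^sup>2)"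
      by (simp add: power2_eq_square algebra_simps)
    thus ?thesis by (simp add: f_def norm_vec_def L2_set_def sum_2 w2)
  qed
  hence orth: "orthogonal_transformation f" using \<open>linear f\<close> by (simp add: orthogonal_transformation)
  have fin: "bij f" using orth by (rule orthogonal_transformation_bij)
  have pre: "{z. w * z \<in> S} \<in> sets borel"
    by (rule borel_preimage_continuous[OF _ S(1)]) (intro continuous_intros)
  have Tb: "T A \<in> sets borel" if "A \<in> sets borel" for A
    unfolding T_def by (rule borel_preimage_continuous[OF _ that]) (auto simp: Complex_eq intro!: continuous_intros)
  have img: "f ` T {z. w * z \<in> S} = T S"
  proof -
    have "w * Complex (v$1) (v$2) = Complex (f v $ 1) (f v $ 2)" for v
      by (simp add: complex_eq_iff f_def)
    hence "T {z. w * z \<in> S} = f -` T S" by (auto simp: T_def)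
    thus ?thesis using fin by (simp add: bij_is_surj surj_image_vimage_eq)
  qed
  obtain B where B: "\<And>z. z \<in> S \<Longrightarrow> cmod z \<le> B" using S(2) by (auto simp: bounded_iff)
  have "norm v \<le> B" if "v \<in> T {z. w * z \<in> S}" for v
  proof -
    have "cmod (Complex (v$1) (v$2)) \<le> B"
      using that B[of "w * Complex (v$1) (v$2)"] w by (simp add: T_def norm_mult)
    thus ?thesis by (simp add: norm_vec_def L2_set_def sum_2 cmod_def)
  qed
  hence "bounded (T {z. w * z \<in> S})" by (auto simp: bounded_iff)
  hence "T {z. w * z \<in> S} \<in> lmeasurable"
    by (intro bounded_set_imp_lmeasurable) (use Tb[OF pre] in auto)
  from measure_orthogonal_image[OF orth this] img
  have "measure lebesgue (T {z. w * z \<in> S}) = measure lebesgue (T S)" by simp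
  thus ?thesis
    using measure_complex_eq_vec2[OF S(1)] measure_complex_eq_vec2[OF pre] Tb[OF S(1)] Tb[OF pre]
    by (simp add: T_def)
qed

text \<open>The factor is the Jacobian in real dimension 2. Negative \<open>r\<close> is allowed, so
  that r = -1 gives the point reflection.\<close>

lemma measure_affine_vimage:
  fixes S :: "complex set"
  assumes "r \<noteq> 0" "S \<in> sets borel"
  shows "measure lborel {w. z + of_real r * w \<in> S} = measure lborel S / r\<^sup>2"
proof -
  have pre: "{w. z + of_real r * w \<in> S} \<in> sets borel"
    by (rule borel_preimage_continuous[OF _ assms(2)]) (intro continuous_intros)
  have "S = (\<lambda>w. r *\<^sub>R w + z) ` {w. z + of_real r * w \<in> S}"
  proof (intro equalityI subsetI)
    fix s assume "s \<in> S"
    thus "s \<in> (\<lambda>w. r *\<^sub>R w + z) ` {w. z + of_real r * w \<in> S}" using assms(1)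
      by (intro image_eqI[of _ _ "(s - z) / of_real r"]) (auto simp: scaleR_conv_of_real)
  qed (auto simp: scaleR_conv_of_real add_ac)
  hence "measure lebesgue S = r\<^sup>2 * measure lebesgue {w. z + of_real r * w \<in> S}"
    using measure_lebesgue_affine[of r z "{w. z + of_real r * w \<in> S}"] by simp
  thus ?thesis using assms pre by (simp add: field_simps)
qed

lemma fund_dom_borel: "fund_dom \<in> sets borel"
proof -
  have eq: "fund_dom = {z. 0 < Im z} \<inter> {z. - 1/2 \<le> Re z} \<inter> {z. Re z \<le> 1/2} \<inter> {z. 1 \<le> cmod z}"
    by (auto simp: fund_dom_def upper_half_plane_def)
  show ?thesis unfolding eq
    by (intro sets.Int borel_open[OF open_Collect_less] borel_closed[OF closed_Collect_le] continuous_intros)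
qed

text \<open>Rescaling the disc of radius \<open>r\<close> to the unit disc, this is dominated convergence of indicators.\<close>

lemma chi_eq_tangent_cone:
  fixes C :: "complex set"
  assumes C: "C \<in> sets borel"
    and cone: "\<And>w. \<forall>\<^sub>F r in at_right 0. z + of_real r * w \<in> fund_dom \<longleftrightarrow> w \<in> C"
  shows "chi z = measure lborel (ball 0 1 \<inter> C) / measure lborel (ball 0 1 :: complex set)"
proof -
  let ?D = "ball 0 1 :: complex set"
  have fin: "emeasure lborel ?D < \<infinity>" by (rule emeasure_lborel_ball_finite)
  have eq: "measure lborel (ball z r \<inter> fund_dom) / measure lborel (ball z r) =
     measure lborel (?D \<inter> {w. z + of_real r * w \<in> fund_dom}) / measure lborel ?D" if "r > 0" for r
  proof -
    have b: "{w. z + of_real r * w \<in> ball z r} = ?D"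
      using that by (auto simp: dist_norm norm_mult)
    have "{w. z + of_real r * w \<in> ball z r \<inter> fund_dom} = ?D \<inter> {w. z + of_real r * w \<in> fund_dom}"
      using b by auto
    hence "measure lborel (?D \<inter> {w. z + of_real r * w \<in> fund_dom}) = measure lborel (ball z r \<inter> fund_dom) / r\<^sup>2"
      using measure_affine_vimage[of r "ball z r \<inter> fund_dom" z] that fund_dom_borel by simp
    moreover have "measure lborel ?D = measure lborel (ball z r) / r\<^sup>2"
      using measure_affine_vimage[of r "ball z r" z] that b by simp
    ultimately show ?thesis using that by simp
  qed
  have meas: "{w. z + of_real r * w \<in> fund_dom} \<in> sets borel" for r
    by (rule borel_preimage_continuous[OF _ fund_dom_borel]) (intro continuous_intros)
  have "((\<lambda>r. \<integral>w. indicator (?D \<inter> {w. z + of_real r * w \<in> fund_dom}) w \<partial>lborel) \<longlongrightarrow>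
        (\<integral>w. indicat_real (?D \<inter> C) w \<partial>lborel)) (at_right 0)"
    \<comment> \<open>The substitution r = 1/t moves the limit to \<open>at_top\<close>; the
      indicator of the unit disc dominates.\<close>
    unfolding filterlim_at_right_to_top
  proof (rule integral_dominated_convergence_at_top[where w = "indicator ?D"])
    show "integrable lborel (indicat_real ?D)" using fin by simp
    show "AE w in lborel. ((\<lambda>t. indicat_real (?D \<inter> {w. z + of_real (inverse t) * w \<in> fund_dom}) w)
            \<longlongrightarrow> indicat_real (?D \<inter> C) w) at_top"
    proof (intro AE_I2 tendsto_eventually)
      fix w
      from cone[of w, unfolded eventually_at_right_to_top]
      show "\<forall>\<^sub>F t in at_top. indicat_real (?D \<inter> {w. z + of_real (inverse t) * w \<in> fund_dom}) w
              = indicat_real (?D \<inter> C) w"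
        by eventually_elim (auto simp: indicator_def)
    qed
    show "indicat_real (?D \<inter> {w. z + of_real (inverse t) * w \<in> fund_dom}) \<in> borel_measurable lborel" for t
      using meas[of "inverse t"] by (intro borel_measurable_indicator) auto
    show "indicat_real (?D \<inter> C) \<in> borel_measurable lborel"
      using C by (intro borel_measurable_indicator) auto
  qed (auto simp: indicator_def)
  hence "((\<lambda>r. measure lborel (?D \<inter> {w. z + of_real r * w \<in> fund_dom}) / measure lborel ?D) \<longlongrightarrow>
     measure lborel (?D \<inter> C) / measure lborel ?D) (at_right 0)"
    by (intro tendsto_divide tendsto_const) (simp_all add: content_ball unit_ball_vol_pos less_imp_neq[symmetric])
  hence "((\<lambda>r. measure lborel (ball z r \<inter> fund_dom) / measure lborel (ball z r)) \<longlongrightarrow>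
     measure lborel (?D \<inter> C) / measure lborel ?D) (at_right 0)"
    by (rule Lim_transform_eventually) (auto simp: eventually_at_filter eq intro!: always_eventually)
  thus ?thesis unfolding chi_def by (intro tendsto_Lim) (auto simp: trivial_limit_at_right_real)
qed

section \<open>Areas of half discs and sectors\<close>

lemma half_disc_borel: "ball 0 1 \<inter> {w. 0 \<le> a \<bullet> w} \<in> sets (borel :: complex measure)"
  by (intro sets.Int borel_open[OF open_ball] borel_closed[OF closed_halfspace_ge])

lemma half_disc_lmeasurable: "ball 0 1 \<inter> {w. 0 \<le> a \<bullet> w} \<in> (lmeasurable :: complex set set)"
  by (intro bounded_set_imp_lmeasurable bounded_Int) (use half_disc_borel[of a] in auto)

text \<open>Point reflection exchanges the two half discs, which overlap in a null set.\<close>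

lemma measure_half_disc:
  fixes a :: complex
  assumes "a \<noteq> 0"
  shows "measure lborel (ball 0 1 \<inter> {w. 0 \<le> a \<bullet> w}) = measure lborel (ball 0 1 :: complex set) / 2"
proof -
  let ?D = "ball 0 1 :: complex set"
  have "measure lebesgue ?D = measure lebesgue (?D \<inter> {w. 0 \<le> a \<bullet> w})
       + measure lebesgue (?D \<inter> {w. 0 \<le> (-a) \<bullet> w}) + measure lebesgue ({} :: complex set)"
  proof (rule measure_Un3_negligible)
    show "negligible (?D \<inter> {w. 0 \<le> a \<bullet> w} \<inter> (?D \<inter> {w. 0 \<le> (-a) \<bullet> w}))"
      by (rule negligible_subset[OF negligible_hyperplane[of a 0]]) (use assms in auto)
  qed (use half_disc_lmeasurable[of a] half_disc_lmeasurable[of "-a"] in auto)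
  moreover have "{w. 0 + of_real (-1) * w \<in> ?D \<inter> {w. 0 \<le> a \<bullet> w}} = ?D \<inter> {w. 0 \<le> (-a) \<bullet> w}"
    by auto
  hence "measure lborel (?D \<inter> {w. 0 \<le> (-a) \<bullet> w}) = measure lborel (?D \<inter> {w. 0 \<le> a \<bullet> w})"
    using measure_affine_vimage[of "-1" "?D \<inter> {w. 0 \<le> a \<bullet> w}" 0] half_disc_borel[of a] by simp
  ultimately show ?thesis using half_disc_borel[of a] half_disc_borel[of "-a"] by simp
qed

definition rho :: complex where "rho = Complex (1/2) (sqrt 3 / 2)"

lemma norm_rho: "cmod rho = 1"
  by (simp add: rho_def cmod_def power2_eq_square)

text \<open>Both are sectors of angle pi/3, the second being \<open>rho\<close> times the first. One
  further rotation gives a third, and the three fill the half disc of \<open>rho - 1\<close> up to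
  null overlaps, so each is a third of a half.\<close>

lemma measure_sector:
  "measure lborel (ball 0 1 \<inter> {w. 0 \<le> 1 \<bullet> w} \<inter> {w. 0 \<le> (rho - 1) \<bullet> w}) = measure lborel (ball 0 1 :: complex set) / 6" (is ?A)
  "measure lborel (ball 0 1 \<inter> {w. 0 \<le> (-1) \<bullet> w} \<inter> {w. 0 \<le> rho \<bullet> w}) = measure lborel (ball 0 1 :: complex set) / 6" (is ?B)
proof -
  let ?D = "ball 0 1 :: complex set"
  define A where "A = (\<lambda>a b. ?D \<inter> {w. 0 \<le> a \<bullet> w} \<inter> {w. 0 \<le> b \<bullet> w})"
  have Ab: "A a b \<in> sets borel" for a b
    unfolding A_def by (intro sets.Int borel_open[OF open_ball] borel_closed[OF closed_halfspace_ge])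
  have bdd: "bounded (A a b)" for a b unfolding A_def by (intro bounded_Int) auto
  have Al: "A a b \<in> lmeasurable" for a b
    by (intro bounded_set_imp_lmeasurable bdd) (use Ab in auto)
  have rot: "(rho * a) \<bullet> (rho * w) = a \<bullet> w" for a w
  proof -
    have r: "Re rho * Re rho + Im rho * Im rho = 1" using norm_rho by (simp add: cmod_def power2_eq_square)
    have "(rho * a) \<bullet> (rho * w) = (Re rho * Re rho + Im rho * Im rho) * (a \<bullet> w)"
      by (simp add: inner_complex_def algebra_simps)
    thus ?thesis by (simp add: r)
  qed
  have "{w. rho * w \<in> A (rho * a) (rho * b)} = A a b" for a b
    by (auto simp: A_def rot norm_mult norm_rho)
  hence step: "measure lborel (A (rho * a) (rho * b)) = measure lborel (A a b)" for a b
    using measure_complex_rotate[OF norm_rho Ab bdd, of "rho * a" "rho * b"] by simp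
  have rho2: "rho * rho = rho - 1" by (simp add: rho_def complex_eq_iff)
  have m1: "measure lborel (A rho (-1)) = measure lborel (A 1 (rho - 1))"
    using step[of 1 "rho - 1"] by (simp add: rho2 algebra_simps)
  have m2: "measure lborel (A (rho - 1) (- rho)) = measure lborel (A rho (-1))"
    using step[of rho "-1"] by (simp add: rho2)
  have nz: "rho \<noteq> 0" "rho - 1 \<noteq> 0" by (auto simp: rho_def complex_eq_iff)
  have "measure lebesgue (?D \<inter> {w. 0 \<le> (rho - 1) \<bullet> w}) = measure lebesgue (A 1 (rho - 1))
       + measure lebesgue (A rho (-1)) + measure lebesgue (A (rho - 1) (- rho))"
  proof (rule measure_Un3_negligible)
    show "negligible (A 1 (rho - 1) \<inter> A rho (-1))" "negligible (A 1 (rho - 1) \<inter> A (rho - 1) (- rho))"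
      by (rule negligible_subset[OF negligible_hyperplane[of 1 0]]; force simp: A_def inner_diff_left)+
    show "negligible (A rho (- 1) \<inter> A (rho - 1) (- rho))"
      by (rule negligible_subset[OF negligible_hyperplane[of rho 0]]; force simp: A_def nz)
    show "A 1 (rho - 1) \<union> A rho (-1) \<union> A (rho - 1) (- rho) = ?D \<inter> {w. 0 \<le> (rho - 1) \<bullet> w}"
      by (auto simp: A_def inner_diff_left)
  qed (rule Al)+
  hence "measure lborel ?D / 2 = 3 * measure lborel (A 1 (rho - 1))"
    using measure_half_disc[OF nz(2)] half_disc_borel[of "rho - 1"] Ab m1 m2 by simp
  thus ?A ?B using m1 by (simp_all add: A_def Int_ac)
qed

text \<open>The first nonzero coefficient decides the sign; \<open>s \<ge> 0\<close> settles p = q =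
  0. For the unit circle s is |w|^2, so directions tangent to it count as inside the domain.\<close>

lemma eventually_quadratic_nonneg_iff:
  fixes p q s :: real
  assumes "s \<ge> 0"
  shows "\<forall>\<^sub>F r in at_right 0. 0 \<le> p + q * r + s * r\<^sup>2 \<longleftrightarrow> 0 < p \<or> p = 0 \<and> 0 \<le> q"
proof -
  have lim: "((\<lambda>r. p + q * r + s * r\<^sup>2) \<longlongrightarrow> p) (at_right 0)"
    by (rule tendsto_eq_intros refl | simp)+
  have lim': "((\<lambda>r. q + s * r) \<longlongrightarrow> q) (at_right 0)"
    by (rule tendsto_eq_intros refl | simp)+
  have pos: "\<forall>\<^sub>F r in at_right 0. r > (0::real)" by (simp add: eventually_at_filter)
  consider "p > 0" | "p < 0" | "p = 0" "q \<ge> 0" | "p = 0" "q < 0" by linarith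
  thus ?thesis
  proof cases
    case 1
    thus ?thesis using order_tendstoD(1)[OF lim, of 0] by (auto elim!: eventually_mono)
  next
    case 2
    thus ?thesis using order_tendstoD(2)[OF lim, of 0] by (auto elim!: eventually_mono)
  next
    case 3
    thus ?thesis using pos assms by (auto elim!: eventually_mono)
  next
    case 4
    have "\<forall>\<^sub>F r in at_right 0. q + s * r < 0" using order_tendstoD(2)[OF lim', of 0] 4 by simp
    with pos show ?thesis
    proof eventually_elim
      case (elim r)
      hence "r * (q + s * r) < 0" by (simp add: mult_pos_neg)
      thus ?case using 4 by (simp add: power2_eq_square algebra_simps)
    qed
  qed
qed

text \<open>The tangent cone is cut out by the constraints active at \<open>z\<close>, with inner
  normals -1, 1 and \<open>z\<close>. It is empty, a sector, a half-plane or everything, which gives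
  the four weights.\<close>

lemma chi_eq_domain_weight:
  assumes z: "Im z > 0"
  shows "chi z = domain_weight (1 - 2 * Re z) (1 + 2 * Re z) ((cmod z)\<^sup>2 - 1)"
proof -
  let ?D = "ball 0 1 :: complex set"
  \<comment> \<open>A constraint with value \<open>p\<close> at \<open>z\<close>: slack ones impose
    nothing, active ones a half-plane, violated ones exclude every direction.\<close>
  define H where "H = (\<lambda>p (a::complex). if p > 0 then UNIV else if p = (0::real) then {w. 0 \<le> a \<bullet> w} else {})"
  define C where "C = H (1 - 2 * Re z) (-1) \<inter> H (1 + 2 * Re z) 1 \<inter> H ((cmod z)\<^sup>2 - 1) z"
  have Hb: "H p a \<in> sets borel" for p a by (auto simp: H_def intro!: borel_closed closed_halfspace_ge)
  have mem: "w \<in> H p a \<longleftrightarrow> 0 < p \<or> p = 0 \<and> 0 \<le> a \<bullet> w" for w p a by (simp add: H_def)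
  have "chi z = measure lborel (?D \<inter> C) / measure lborel ?D"
  proof (rule chi_eq_tangent_cone)
    show "C \<in> sets borel" unfolding C_def by (intro sets.Int Hb)
    fix w
    have "((\<lambda>r. Im (z + of_real r * w)) \<longlongrightarrow> Im (z + of_real 0 * w)) (at_right 0)"
      by (intro tendsto_intros)
    hence "\<forall>\<^sub>F r in at_right 0. Im (z + of_real r * w) > 0" using z by (intro order_tendstoD(1)) auto
    with eventually_quadratic_nonneg_iff[OF order_refl, of "1 - 2 * Re z" "- 2 * Re w"]
         eventually_quadratic_nonneg_iff[OF order_refl, of "1 + 2 * Re z" "2 * Re w"]
         eventually_quadratic_nonneg_iff[OF zero_le_power2[of "cmod w"], of "(cmod z)\<^sup>2 - 1" "2 * (z \<bullet> w)"]
    show "\<forall>\<^sub>F r in at_right 0. z + of_real r * w \<in> fund_dom \<longleftrightarrow> w \<in> C"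
    proof eventually_elim
      case (elim r)
      have n: "1 \<le> cmod u \<longleftrightarrow> 0 \<le> (cmod u)\<^sup>2 - 1" for u
        using abs_le_square_iff[of 1 "cmod u"] by simp
      have sq: "(cmod (z + of_real r * w))\<^sup>2 - 1 = (cmod z)\<^sup>2 - 1 + 2 * (z \<bullet> w) * r + (cmod w)\<^sup>2 * r\<^sup>2"
        unfolding cmod_power2 by (simp add: inner_complex_def power2_eq_square algebra_simps)
      show ?case
        unfolding fund_dom_def upper_half_plane_def C_def Int_iff mem mem_Collect_eq n sq
        using elim by (auto simp: algebra_simps)
    qed
  qed
  also have "\<dots> = domain_weight (1 - 2 * Re z) (1 + 2 * Re z) ((cmod z)\<^sup>2 - 1)"
  proof -
    have D: "measure lborel ?D \<noteq> 0" by (simp add: content_ball unit_ball_vol_pos less_imp_neq[symmetric])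
    have z0: "z \<noteq> 0" using z by auto
    \<comment> \<open>The left corner is rho^2, which equals \<open>rho - 1\<close>.\<close>
    have corner: "z = (if Re z = 1/2 then rho else rho - 1)" if "(cmod z)\<^sup>2 = 1" "\<bar>Re z\<bar> = 1/2"
    proof -
      have "(Re z)\<^sup>2 = \<bar>Re z\<bar>\<^sup>2" by simp
      hence "(Re z)\<^sup>2 = 1/4" unfolding that(2) by (simp add: power2_eq_square)
      hence "(Im z)\<^sup>2 = 3/4" using that(1) by (simp add: cmod_power2)
      hence "Im z = sqrt (3/4)" using z by (metis real_sqrt_unique less_imp_le)
      hence "Im z = sqrt 3 / 2" by (simp add: real_sqrt_divide)
      thus ?thesis using that(2) by (auto simp: rho_def complex_eq_iff)
    qed
    show ?thesis
    proof (cases "1 - 2 * Re z < 0 \<or> 1 + 2 * Re z < 0 \<or> (cmod z)\<^sup>2 - 1 < 0")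
      case True
      hence "C = {}" by (auto simp: C_def H_def)
      thus ?thesis using True by (auto simp: domain_weight_def)
    next
      case nn: False
      show ?thesis
      proof (cases "(cmod z)\<^sup>2 - 1 = 0 \<and> (1 - 2 * Re z = 0 \<or> 1 + 2 * Re z = 0)")
        case True
        have zc: "z = (if Re z = 1/2 then rho else rho - 1)" using True by (intro corner) auto
        have "measure lborel (?D \<inter> C) = measure lborel ?D / 6"
        proof (cases "Re z = 1/2")
          case r: True
          have "C = {w. 0 \<le> (-1) \<bullet> w} \<inter> {w. 0 \<le> rho \<bullet> w}" using zc r True by (auto simp: C_def H_def)
          thus ?thesis using measure_sector(2) by (simp add: Int_assoc)
        next
          case r: False
          have "C = {w. 0 \<le> 1 \<bullet> w} \<inter> {w. 0 \<le> (rho - 1) \<bullet> w}" using zc r True by (auto simp: C_def H_def)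
          thus ?thesis using measure_sector(1) by (simp add: Int_assoc)
        qed
        thus ?thesis using True D nn by (simp add: domain_weight_def)
      next
        case nc: False
        show ?thesis
        proof (cases "(cmod z)\<^sup>2 - 1 = 0 \<or> 1 - 2 * Re z = 0 \<or> 1 + 2 * Re z = 0")
          case True
          have "\<exists>a. a \<noteq> 0 \<and> C = {w. 0 \<le> a \<bullet> w}"
            using True
          proof (elim disjE)
            assume "(cmod z)\<^sup>2 - 1 = 0"
            hence "C = {w. 0 \<le> z \<bullet> w}" using nc nn by (auto simp: C_def H_def)
            thus ?thesis using z0 by blast
          next
            assume "1 - 2 * Re z = 0"
            hence "C = {w. 0 \<le> (-1) \<bullet> w}" using nc nn by (auto simp: C_def H_def)
            thus ?thesis by (metis neg_equal_0_iff_equal one_neq_zero)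
          next
            assume "1 + 2 * Re z = 0"
            hence "C = {w. 0 \<le> 1 \<bullet> w}" using nc nn by (auto simp: C_def H_def)
            thus ?thesis by (metis one_neq_zero)
          qed
          then obtain a where "a \<noteq> 0" "C = {w. 0 \<le> a \<bullet> w}" by blast
          thus ?thesis using measure_half_disc[of a] D True nc nn by (auto simp: domain_weight_def)
        next
          case False
          hence "C = UNIV" using nn by (auto simp: C_def H_def)
          thus ?thesis using False nn D by (auto simp: domain_weight_def)
        qed
      qed
    qed
  qed
  finally show ?thesis .
qed

section \<open>Cosets and fixed points\<close>

definition mat22 :: "int \<Rightarrow> int \<Rightarrow> int \<Rightarrow> int \<Rightarrow> int^2^2" where
  "mat22 a b c d = vector [vector [a, b], vector [c, d]]"

lemma mat22_nth [simp]: "mat22 a b c d $ 1 $ 1 = a" "mat22 a b c d $ 1 $ 2 = b" "mat22 a b c d $ 2 $ 1 = c" "mat22 a b c d $ 2 $ 2 = d"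
  by (simp_all add: mat22_def)

lemma mat22_cases: obtains a b c d where "A = mat22 a b c d"
  by (rule that[of "A$1$1" "A$1$2" "A$2$1" "A$2$2"]) (simp add: vec_eq_iff forall_2)

lemma mat22_eq_iff [simp]: "mat22 a b c d = mat22 a' b' c' d' \<longleftrightarrow> a = a' \<and> b = b' \<and> c = c' \<and> d = d'"
  by (auto simp: vec_eq_iff forall_2)

lemma uminus_mat22: "- mat22 a b c d = mat22 (-a) (-b) (-c) (-d)"
  by (simp add: vec_eq_iff forall_2)

lemma mat22_mult: "mat22 a b c d ** mat22 a' b' c' d' = mat22 (a*a' + b*c') (a*b' + b*d') (c*a' + d*c') (c*b' + d*d')"
  by (simp add: vec_eq_iff forall_2 matrix_matrix_mult_def sum_2)

lemma mat_eq_mat22: "mat r = mat22 r 0 0 r"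
  by (simp add: vec_eq_iff forall_2 mat_def)

lemma abs_pmat_cases: obtains a b c d where "M = abs_pmat (mat22 a b c d)"
proof -
  obtain A where "M = abs_pmat A" by (induct M rule: pmat.abs_induct) blast
  thus ?thesis using that by (cases A rule: mat22_cases) blast
qed

lemma abs_mat22_eq_iff: "abs_pmat (mat22 a b c d) = abs_pmat (mat22 a' b' c' d') \<longleftrightarrow>
    (a = a' \<and> b = b' \<and> c = c' \<and> d = d') \<or> (a = -a' \<and> b = -b' \<and> c = -c' \<and> d = -d')"
  by (simp add: pmat.abs_eq_iff pm_eq_def uminus_mat22)

lemma pdet_mat22 [simp]: "pdet (abs_pmat (mat22 a b c d)) = a * d - b * c"
  by (simp add: pdet.abs_eq det_2)

lemma pmult_mat22: "abs_pmat (mat22 a b c d) \<odot> abs_pmat (mat22 a' b' c' d') =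
    abs_pmat (mat22 (a*a' + b*c') (a*b' + b*d') (c*a' + d*c') (c*b' + d*d'))"
  by (simp add: pmult.abs_eq mat22_mult)

lemma pscalar_eq: "pscalar r = abs_pmat (mat22 r 0 0 r)"
  by (simp add: pscalar.abs_eq mat_eq_mat22)

lemma bottom_gcd_mat22 [simp]: "bottom_gcd (abs_pmat (mat22 a b c d)) = gcd c d"
  by (simp add: bottom_gcd.abs_eq)

lemma elliptic_mat22: "elliptic (abs_pmat (mat22 a b c d)) \<longleftrightarrow> (a + d)\<^sup>2 < 4 * (a * d - b * c)"
  by (simp add: elliptic.abs_eq det_2 trace_def sum_2)

lemma pmult_assoc: "(A \<odot> B) \<odot> C = A \<odot> (B \<odot> C)"
  by transfer (simp add: pm_eq_def matrix_mul_assoc)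

lemma pdet_pmult: "pdet (A \<odot> B) = pdet A * pdet B"
  by transfer (simp add: det_mul)

lemma coset_self: "M \<in> coset M"
proof -
  have "M \<odot> pscalar 1 = M" by (cases M rule: abs_pmat_cases) (simp add: pscalar_eq pmult_mat22)
  thus ?thesis unfolding coset_def Gamma_def Mn_def
    by (intro image_eqI[of _ _ "pscalar 1"]) (simp_all add: pscalar_eq)
qed

lemma coset_eqI:
  assumes "M \<in> coset P"
  shows "coset M = coset P"
proof -
  obtain g where g: "pdet g = 1" "M = P \<odot> g" using assms by (auto simp: coset_def Gamma_def Mn_def)
  obtain a b c d where geq: "g = abs_pmat (mat22 a b c d)" by (rule abs_pmat_cases)
  define g' where "g' = abs_pmat (mat22 d (-b) (-c) a)"
  have det: "a * d - b * c = 1" using g geq by simp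
  have g': "pdet g' = 1" using det by (simp add: g'_def mult.commute)
  have inv: "g \<odot> g' = pscalar 1" using det by (simp add: geq g'_def pmult_mat22 pscalar_eq mult.commute)
  have one: "pscalar 1 \<odot> h = h" for h by (cases h rule: abs_pmat_cases) (simp add: pscalar_eq pmult_mat22)
  show ?thesis
  proof (intro equalityI subsetI)
    fix x assume "x \<in> coset M"
    then obtain h where "pdet h = 1" "x = M \<odot> h" by (auto simp: coset_def Gamma_def Mn_def)
    thus "x \<in> coset P" using g unfolding coset_def Gamma_def Mn_def
      by (intro image_eqI[of _ _ "g \<odot> h"]) (simp_all add: pmult_assoc pdet_pmult)
  next
    fix x assume "x \<in> coset P"
    then obtain h where "pdet h = 1" "x = P \<odot> h" by (auto simp: coset_def Gamma_def Mn_def)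
    moreover have "P \<odot> h = M \<odot> (g' \<odot> h)"
      unfolding g(2) pmult_assoc by (simp add: pmult_assoc[symmetric] inv) (simp add: pmult_assoc one)
    ultimately show "x \<in> coset M" using g' unfolding coset_def Gamma_def Mn_def
      by (intro image_eqI[of _ _ "g' \<odot> h"]) (simp_all add: pdet_pmult)
  qed
qed

text \<open>Hermite normal form by column operations.\<close>

lemma coset_upper_triangular:
  assumes n: "n \<ge> 1" and K: "K \<in> cosets n"
  obtains \<alpha> \<beta> \<delta> where "\<alpha> > 0" "\<delta> > 0" "\<alpha> * \<delta> = int n" "K = coset (abs_pmat (mat22 \<alpha> \<beta> 0 \<delta>))"
proof -
  obtain M where M: "pdet M = int n" "K = coset M" using K by (auto simp: cosets_def Mn_def)
  obtain a b c d where Meq: "M = abs_pmat (mat22 a b c d)" by (rule abs_pmat_cases)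
  have det: "a * d - b * c = int n" using M Meq by simp
  define \<delta> where "\<delta> = gcd c d"
  have "c \<noteq> 0 \<or> d \<noteq> 0" using det n by auto
  hence \<delta>: "\<delta> > 0" by (simp add: \<delta>_def)
  obtain c' d' where cd: "c = \<delta> * c'" "d = \<delta> * d'" by (metis \<delta>_def dvdE gcd_dvd1 gcd_dvd2)
  obtain u v where "u * c + v * d = \<delta>" unfolding \<delta>_def using bezout_int by blast
  hence "\<delta> * (u * c' + v * d') = \<delta> * 1" by (simp add: cd algebra_simps)
  hence uv: "u * c' + v * d' = 1" using \<delta> by simp
  \<comment> \<open>The first column annihilates the bottom row (c, d); the second is a Bezout pair,
    giving determinant 1 and lower right entry gcd(c, d).\<close>
  define g where "g = abs_pmat (mat22 d' u (-c') v)"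
  have "pdet g = 1" using uv by (simp add: g_def algebra_simps)
  define \<alpha> \<beta> where "\<alpha> = a * d' - b * c'" and "\<beta> = a * u + b * v"
  have "\<delta> * (c' * u + d' * v) = \<delta>" using uv by (simp add: mult.commute)
  hence "M \<odot> g = abs_pmat (mat22 \<alpha> \<beta> 0 \<delta>)"
    by (simp add: Meq g_def pmult_mat22 \<alpha>_def \<beta>_def cd algebra_simps)
  moreover have "M \<odot> g \<in> coset M" using \<open>pdet g = 1\<close> by (auto simp: coset_def Gamma_def Mn_def)
  ultimately have "K = coset (abs_pmat (mat22 \<alpha> \<beta> 0 \<delta>))" using coset_eqI M by metis
  moreover have ad: "\<alpha> * \<delta> = int n" using det by (simp add: \<alpha>_def cd algebra_simps)
  moreover have "\<alpha> > 0" using ad n \<delta> by (metis of_nat_0_less_iff zero_less_mult_pos2 less_le_trans zero_less_one)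
  ultimately show ?thesis using that \<delta> by blast
qed

text \<open>Imaginary and real part of the fixed point equation give 2 c Re z = a - d and b = -c
  |z|^2. Multiplying the three arguments of the weight by c > 0 makes them linear in the
  entries.\<close>

lemma chi_fixed_pt:
  assumes ell: "elliptic (abs_pmat (mat22 a b c d))" and c: "c > 0"
  shows "chi (fixed_pt (abs_pmat (mat22 a b c d))) =
    domain_weight (of_int c + of_int d - of_int a) (of_int c - of_int d + of_int a) (- of_int b - of_int c)"
proof -
  define z where "z = fixed_pt (abs_pmat (mat22 a b c d))"
  have "z \<in> upper_half_plane \<and> pmoebius (abs_pmat (mat22 a b c d)) z = z"
    unfolding z_def fixed_pt_def by (rule theI'[OF elliptic_fixed_pt[OF ell]])
  hence y: "Im z > 0" and fp: "moebius (of_int a) (of_int b) (of_int c) (of_int d) z = z"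
    by (simp_all add: upper_half_plane_def pmoebius.abs_eq)
  have "Im (of_int c * z + of_int d) \<noteq> 0" using y c by simp
  hence "of_int c * z + of_int d \<noteq> 0" by (metis zero_complex.simps(2))
  hence eq: "of_int a * z + of_int b = z * (of_int c * z + of_int d)"
    using fp by (simp add: moebius_def divide_eq_eq)
  have "of_int a * Im z = Re z * (of_int c * Im z) + Im z * (of_int c * Re z + of_int d)"
    using arg_cong[OF eq, of Im] by simp
  hence "Im z * (2 * of_int c * Re z - (of_int a - of_int d)) = 0" by (simp add: algebra_simps)
  hence re: "2 * of_int c * Re z = of_int a - of_int d" using y by simp
  have "of_int a * Re z + of_int b = Re z * (of_int c * Re z + of_int d) - Im z * (of_int c * Im z)"
    using arg_cong[OF eq, of Re] by simp
  hence "of_int b = of_int c * (Re z)\<^sup>2 - of_int c * (Im z)\<^sup>2 - (of_int a - of_int d) * Re z"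
    by (simp add: power2_eq_square algebra_simps)
  also have "\<dots> = - of_int c * (cmod z)\<^sup>2"
    unfolding re[symmetric] cmod_power2 by (simp add: power2_eq_square algebra_simps)
  finally have ab: "of_int b = - of_int c * (cmod z)\<^sup>2" .
  have "chi z = domain_weight (of_int c * (1 - 2 * Re z)) (of_int c * (1 + 2 * Re z)) (of_int c * ((cmod z)\<^sup>2 - 1))"
    using c y by (subst domain_weight_scale) (auto simp: chi_eq_domain_weight)
  also have "of_int c * (1 - 2 * Re z) = of_int c + of_int d - of_int a" using re by (simp add: algebra_simps)
  also have "of_int c * (1 + 2 * Re z) = of_int c - of_int d + of_int a" using re by (simp add: algebra_simps)
  also have "of_int c * ((cmod z)\<^sup>2 - 1) = - of_int b - of_int c" using ab by (simp add: algebra_simps)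
  finally show ?thesis by (simp add: z_def)
qed

text \<open>The discriminant (a - d)^2 + 4 b c is at most c^2 - 4 c^2 < 0. Hence every element of
  nonzero tile weight takes part in the sum.\<close>

lemma elliptic_of_strip:
  assumes "c > 0" "a - d \<le> c" "d - a \<le> c" "b \<le> - c"
  shows "elliptic (abs_pmat (mat22 a b c d))"
proof -
  have "(a - d)\<^sup>2 \<le> c\<^sup>2" using assms by (intro power2_le_iff_abs_le[THEN iffD2]) auto
  moreover have "b * c \<le> - c * c" using assms by (intro mult_right_mono) auto
  moreover have "c * c > 0" using assms by simp
  ultimately have "(a - d)\<^sup>2 + 4 * (b * c) < 0" by (simp add: power2_eq_square)
  thus ?thesis by (simp add: elliptic_mat22 power2_eq_square algebra_simps)
qed

theorem theorem2:
  fixes n :: nat and K :: "pmat set"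
  assumes "n \<ge> 1" and "K \<in> cosets n"
  shows "((\<lambda>M. chi (fixed_pt M)) has_sum
           (1 + sgn (real n / real_of_int (delta K) - real_of_int (delta K))
              + (if \<exists>r::nat. r\<^sup>2 = n \<and> K = coset (pscalar (int r)) then 1/6 else 0)))
         {M \<in> K. elliptic M}"
proof -
  obtain \<alpha> \<beta> \<delta> where pos: "\<alpha> > 0" "\<delta> > 0" and n: "\<alpha> * \<delta> = int n"
    and K: "K = coset (abs_pmat (mat22 \<alpha> \<beta> 0 \<delta>))"
    using coset_upper_triangular[OF assms] by metis
  define x y :: real where "x = of_int \<beta> / of_int \<delta>" and "y = of_int \<alpha> / of_int \<delta>"
  define \<Phi> where "\<Phi> = (\<lambda>(a,b,c,d). abs_pmat (mat22 (\<alpha>*a + \<beta>*c) (\<alpha>*b + \<beta>*d) (\<delta>*c) (\<delta>*d)))"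
  have \<Phi>: "\<Phi> (a,b,c,d) = abs_pmat (mat22 \<alpha> \<beta> 0 \<delta>) \<odot> abs_pmat (mat22 a b c d)" for a b c d
    by (simp add: \<Phi>_def pmult_mat22)
  have delta: "delta K = \<delta>"
    using delta_eq[OF assms(2), of "abs_pmat (mat22 \<alpha> \<beta> 0 \<delta>)"] coset_self pos by (simp add: K)
  \<comment> \<open>Rules out the negative sign in \<open>abs_mat22_eq_iff\<close>: two positive
    lower left entries cannot be opposite.\<close>
  have "\<delta> * u \<noteq> - (\<delta> * v)" if "u > 0" "v > 0" for u v
  proof -
    have "\<delta> * u > 0" "\<delta> * v > 0" using pos that by simp_all
    thus ?thesis by linarith
  qed
  hence inj: "inj_on \<Phi> SL2_pos"
    using pos by (auto simp: inj_on_def \<Phi>_def abs_mat22_eq_iff SL2_pos_def)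
  have scaled: "slack_right (a,b,c,d) x y = (of_int (\<delta>*c) + of_int (\<delta>*d) - of_int (\<alpha>*a + \<beta>*c)) / of_int \<delta>"
    "slack_left (a,b,c,d) x y = (of_int (\<delta>*c) - of_int (\<delta>*d) + of_int (\<alpha>*a + \<beta>*c)) / of_int \<delta>"
    "slack_bottom (a,b,c,d) x y = (- of_int (\<alpha>*b + \<beta>*d) - of_int (\<delta>*c)) / of_int \<delta>" for a b c d
    using pos by (simp_all add: x_def y_def field_simps)
  have val: "chi (fixed_pt (\<Phi> g)) = tile_weight g x y" if "g \<in> SL2_pos" "elliptic (\<Phi> g)" for g
  proof -
    obtain a b c d where g: "g = (a,b,c,d)" by (cases g)
    have c: "\<delta> * c > 0" using that pos by (simp add: g SL2_pos_def)
    show ?thesis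
      using chi_fixed_pt[OF that(2)[unfolded g \<Phi>_def prod.case] c] pos
        domain_weight_scale[of "1 / of_int \<delta>"]
      unfolding g tile_weight_def scaled by (simp add: \<Phi>_def)
  qed
  have ell: "elliptic (\<Phi> g)" if "g \<in> SL2_pos" "tile_weight g x y \<noteq> 0" for g
  proof -
    obtain a b c d where g: "g = (a,b,c,d)" by (cases g)
    have c: "\<delta> * c > 0" using that pos by (simp add: g SL2_pos_def)
    have "0 \<le> real_of_int (\<delta>*c + \<delta>*d - (\<alpha>*a + \<beta>*c))" "0 \<le> real_of_int (\<delta>*c - \<delta>*d + (\<alpha>*a + \<beta>*c))"
      "0 \<le> real_of_int (- (\<alpha>*b + \<beta>*d) - \<delta>*c)"
      using tile_weight_nonzeroD[OF that(2), unfolded g scaled] pos by (simp_all add: zero_le_divide_iff)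
    thus ?thesis unfolding g \<Phi>_def prod.case using c by (intro elliptic_of_strip) linarith+
  qed
  define S where "S = {g \<in> SL2_pos. elliptic (\<Phi> g)}"
  have image: "{M \<in> K. elliptic M} = \<Phi> ` S"
  proof (intro equalityI subsetI)
    fix M assume M: "M \<in> {M \<in> K. elliptic M}"
    then obtain h where h: "pdet h = 1" "M = abs_pmat (mat22 \<alpha> \<beta> 0 \<delta>) \<odot> h"
      by (auto simp: K coset_def Gamma_def Mn_def)
    obtain a b c d where heq: "h = abs_pmat (mat22 a b c d)" by (rule abs_pmat_cases)
    have det: "a * d - b * c = 1" using h heq by simp
    have Meq: "M = \<Phi> (a,b,c,d)" using h heq \<Phi> by simp
    \<comment> \<open>A triangular matrix has real eigenvalues, so its discriminant is a square and
      it is not elliptic.\<close>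
    have "c \<noteq> 0"
    proof
      assume c: "c = 0"
      hence "a * d = 1" using det by simp
      hence ad: "a = 1 \<and> d = 1 \<or> a = -1 \<and> d = -1" by (rule zmult_eq_1_iff[THEN iffD1])
      have "elliptic M" using M by simp
      hence "(\<alpha> * a + \<delta> * d)\<^sup>2 < 4 * (\<alpha> * a * (\<delta> * d))"
        unfolding Meq \<Phi>_def prod.case elliptic_mat22 by (simp add: c)
      hence "(\<alpha> * a - \<delta> * d)\<^sup>2 < 0" by (simp add: power2_eq_square algebra_simps)
      thus False by simp
    qed
    show "M \<in> \<Phi> ` S"
    proof (cases "c > 0")
      case True
      thus ?thesis using M det by (auto simp: S_def SL2_pos_def Meq)
    next
      case False
      have "M = \<Phi> (-a,-b,-c,-d)" by (simp add: Meq \<Phi>_def abs_mat22_eq_iff)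
      moreover have "(-a,-b,-c,-d) \<in> SL2_pos" using False \<open>c \<noteq> 0\<close> det by (simp add: SL2_pos_def)
      ultimately show ?thesis using M by (auto simp: S_def)
    qed
  next
    fix M assume "M \<in> \<Phi> ` S"
    then obtain a b c d where "(a,b,c,d) \<in> SL2_pos" "elliptic (\<Phi> (a,b,c,d))" "M = \<Phi> (a,b,c,d)"
      by (auto simp: S_def)
    thus "M \<in> {M \<in> K. elliptic M}"
      by (auto simp: K coset_def Gamma_def Mn_def \<Phi> SL2_pos_def intro!: image_eqI)
  qed
  define T where "T = {g \<in> SL2_pos. tile_weight g x y \<noteq> 0}"
  have "finite T"
  proof -
    obtain G where "finite G" "\<And>g. g \<in> SL2_pos \<Longrightarrow> tile_weight g x y \<noteq> 0 \<Longrightarrow> g \<in> G"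
      using finite_support[of "\<bar>x\<bar>" y] by (metis order_refl)
    moreover have "T \<subseteq> G" using calculation(2) by (auto simp: T_def)
    ultimately show ?thesis using finite_subset by blast
  qed
  hence "((\<lambda>g. tile_weight g x y) has_sum tile_sum x y) T"
    unfolding tile_sum_def T_def[symmetric] by (rule has_sum_finite)
  \<comment> \<open>\<open>T\<close> lies in \<open>S\<close> by \<open>ell\<close>, and elliptic
    elements outside \<open>T\<close> have weight 0, so the possibly larger index set
    \<open>S\<close> has the same sum.\<close>
  moreover have "((\<lambda>g. tile_weight g x y) has_sum tile_sum x y) T \<longleftrightarrow> ((\<lambda>M. chi (fixed_pt M)) \<circ> \<Phi> has_sum tile_sum x y) S"
    by (rule has_sum_cong_neutral) (auto simp: T_def S_def val ell)
  ultimately have "((\<lambda>M. chi (fixed_pt M)) has_sum tile_sum x y) (\<Phi> ` S)"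
    using has_sum_reindex[of \<Phi> S] inj by (metis (no_types, lifting) S_def inj_on_subset mem_Collect_eq subsetI)
  moreover have "sgn (real n / real_of_int (delta K) - real_of_int (delta K)) = sgn (y - 1)"
  proof -
    have "real n = of_int \<alpha> * of_int \<delta>" using n by (metis of_int_mult of_int_of_nat_eq)
    hence "real n / real_of_int (delta K) - real_of_int (delta K) = of_int \<delta> * (y - 1)"
      using pos by (simp add: delta y_def field_simps)
    thus ?thesis using pos by (simp add: sgn_mult)
  qed
  \<comment> \<open>The scalar coset is the case \<alpha> = \<delta> with \<delta> dividing \<beta>:
    then the triangular representative is \<delta> times a power of T.\<close>
  moreover have "(\<exists>r::nat. r\<^sup>2 = n \<and> K = coset (pscalar (int r))) \<longleftrightarrow> y = 1 \<and> x \<in> \<int>"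
  proof
    assume "\<exists>r::nat. r\<^sup>2 = n \<and> K = coset (pscalar (int r))"
    then obtain r :: nat where r: "r\<^sup>2 = n" "K = coset (pscalar (int r))" by blast
    have "delta K = int r"
      using delta_eq[OF assms(2), of "pscalar (int r)"] coset_self[of "pscalar (int r)"] by (simp add: r(2) pscalar_eq)
    hence \<delta>: "\<delta> = int r" using delta by simp
    have "\<alpha> * \<delta> = \<delta> * \<delta>" using n r(1) by (simp add: \<delta> power2_eq_square flip: of_nat_mult)
    hence "\<alpha> = \<delta>" using pos by simp
    have "abs_pmat (mat22 \<alpha> \<beta> 0 \<delta>) \<in> coset (pscalar (int r))" using coset_self K r(2) by metis
    then obtain h where h: "abs_pmat (mat22 \<alpha> \<beta> 0 \<delta>) = pscalar \<delta> \<odot> h" by (auto simp: coset_def \<delta>)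
    obtain a b c d where "h = abs_pmat (mat22 a b c d)" by (rule abs_pmat_cases)
    hence "\<beta> = \<delta> * b \<or> \<beta> = - (\<delta> * b)" using h by (auto simp: pscalar_eq pmult_mat22 abs_mat22_eq_iff)
    hence "x = of_int b \<or> x = of_int (- b)" using pos by (auto simp: x_def)
    thus "y = 1 \<and> x \<in> \<int>" using \<open>\<alpha> = \<delta>\<close> pos by (auto simp: y_def)
  next
    assume xy: "y = 1 \<and> x \<in> \<int>"
    hence \<alpha>: "\<alpha> = \<delta>" using pos by (simp add: y_def)
    obtain k where "x = of_int k" using xy by (auto elim: Ints_cases)
    hence "real_of_int \<beta> = of_int (\<delta> * k)" using pos by (simp add: x_def field_simps)
    hence \<beta>: "\<beta> = \<delta> * k" by linarith
    have "abs_pmat (mat22 \<alpha> \<beta> 0 \<delta>) = pscalar \<delta> \<odot> abs_pmat (mat22 1 k 0 1)"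
      by (simp add: pscalar_eq pmult_mat22 \<alpha> \<beta>)
    hence "abs_pmat (mat22 \<alpha> \<beta> 0 \<delta>) \<in> coset (pscalar \<delta>)" by (auto simp: coset_def Gamma_def Mn_def)
    hence "K = coset (pscalar (int (nat \<delta>)))" using coset_eqI K pos by simp
    moreover have "(nat \<delta>)\<^sup>2 = n" using n pos by (simp add: \<alpha> power2_eq_square flip: nat_mult_distrib)
    ultimately show "\<exists>r::nat. r\<^sup>2 = n \<and> K = coset (pscalar (int r))" by blast
  qed
  ultimately show ?thesis unfolding image tile_sum_eq by simp
qed

end
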